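(* Let $G$ be a bipartite periodic graph, let $\hat G$ be its projection on the torus $\mathbb{T}^2=\mathbb{R}^2/\mathbb{Z}^2$, and let $\omega_0$ be a perfect matching of $\hat G$. Let $N_{\omega_0}(G)\subset\mathbb{R}^2$ be the convex hull of the set $\{h_{\omega_0}(\omega)\mid \omega\in\mathcal{M}(\hat G)\}$. Then \[N_{\omega_0}(G)\cap\mathbb{Z}^2=\{h_{\omega_0}(\omega)\mid \omega\in\mathcal{M}(\hat G)\}.\]
   Context: Graphs may have loops and multiple edges. A periodic graph is a graph $G$ (not necessarily connected) together with a cellular embedding of it in the plane $\mathbb{R}^2$ (an embedding whose restriction onto its image is a homeomorphism, and whose complement is a disjoint union of open discs) such that translation by every vector of $\mathbb{Z}^2$ is a graph automorphism. Its image under the quotient map $\mathbb{R}^2\to\mathbb{T}^2=\mathbb{R}^2/\mathbb{Z}^2$ is an embedded finite graph $\hat G$ in the torus. $\mathcal{M}(\hat G)$ denotes the set of perfect matchings of $\hat G$ (sets of edges covering every vertex exactly once); it is assumed nonempty. Every edge of the bipartite graph is oriented from its white vertex to its black vertex. For $\omega,\omega_0\in\mathcal{M}(\hat G)$, the transition graph $\omega-\omega_0$ consists of the edges of $\omega$ with their orientation and the edges of $\omega_0$ with reversed orientation; its components are directed circuits in the torus together with pairs of vertices joined in both directions (from edges common to $\omega$ and $\omega_0$), which are discarded. The transition graph is thus an oriented 1-cycle on $\mathbb{T}^2$, and $h_{\omega_0}(\omega)\in\mathbb{Z}^2=H_1(\mathbb{T}^2;\mathbb{Z})$ denotes its homology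 class (homology type). *)

theory Defs
  imports "HOL-Analysis.Analysis" "HOL-Homology.Homology"
begin

type_synonym plane = "real \<times> real"

text \<open>
  A graph embedded in the plane is given by its set \<open>V\<close> of vertices (points) and its set \<open>E\<close> of
  closed edges (subsets of the plane). Loops are simple closed curves with \<open>pathstart g = pathfinish g\<close>;
  parallel edges are distinct subsets with the same end points. The last conjunct says that the
  subspace topology on the image is the topology of the graph as a one-dimensional cell
  complex (the weak topology with respect to its closed edges), i.e. that the embedding is a
  homeomorphism onto its image.
\<close>

definition embedded_graph :: "plane set \<Rightarrow> plane set set \<Rightarrow> bool" where
  "embedded_graph V E \<longleftrightarrow>
     (\<forall>e\<in>E. \<exists>g. simple_path g \<and> path_image g = e \<and> e \<inter> V = {pathstart g, pathfinish g}) \<and>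
     (\<forall>e\<in>E. \<forall>e'\<in>E. e \<noteq> e' \<longrightarrow> e \<inter> e' \<subseteq> V) \<and>
     (\<forall>S \<subseteq> V \<union> \<Union>E. closedin (top_of_set (V \<union> \<Union>E)) S \<longleftrightarrow>
                    (\<forall>e\<in>E. closedin (top_of_set e) (S \<inter> e)))"

definition cellular_graph :: "plane set \<Rightarrow> plane set set \<Rightarrow> bool" where
  "cellular_graph V E \<longleftrightarrow> embedded_graph V E \<and>
     (\<forall>C \<in> components (- (V \<union> \<Union>E)). C homeomorphic ball (0 :: plane) 1)"

definition periodic_graph :: "plane set \<Rightarrow> plane set set \<Rightarrow> bool" where
  "periodic_graph V E \<longleftrightarrow> cellular_graph V E \<and>
     (\<forall>a \<in> \<int> \<times> \<int>. (+) a ` V = V \<and> (\<lambda>e. (+) a ` e) ` E = E)"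

text \<open>
  The colouring is required to be invariant under translations, so that it descends to the torus.
\<close>

definition bipartite_periodic_graph ::
    "plane set \<Rightarrow> plane set set \<Rightarrow> plane set \<Rightarrow> plane set \<Rightarrow> bool" where
  "bipartite_periodic_graph V E W B \<longleftrightarrow> periodic_graph V E \<and>
     V = W \<union> B \<and> W \<inter> B = {} \<and>
     (\<forall>e\<in>E. \<exists>w\<in>W. \<exists>b\<in>B. e \<inter> V = {w, b}) \<and>
     (\<forall>a \<in> \<int> \<times> \<int>. (+) a ` W = W \<and> (+) a ` B = B)"

text \<open>The torus \<open>\<real>\<^sup>2/\<int>\<^sup>2\<close> is realised as a product of two unit circles.\<close>

type_synonym torus_point = "complex \<times> complex"

definition torus :: "torus_point topology" where
  "torus = top_of_set (sphere 0 1 \<times> sphere 0 1)"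

definition torus_proj :: "plane \<Rightarrow> torus_point" where
  "torus_proj p = (cis (2 * pi * fst p), cis (2 * pi * snd p))"

lemma cis_eq_iff_diff_Ints: "cis (2 * pi * x) = cis (2 * pi * y) \<longleftrightarrow> x - y \<in> \<int>"
proof -
  have "cis (2 * pi * x) = cis (2 * pi * y) \<longleftrightarrow>
        sin (2 * pi * x) = sin (2 * pi * y) \<and> cos (2 * pi * x) = cos (2 * pi * y)"
    by (auto simp: complex_eq_iff)
  also have "\<dots> \<longleftrightarrow> (\<exists>n::int. 2 * pi * x = 2 * pi * y + 2 * pi * of_int n)"
    by (simp add: sin_cos_eq_iff)
  also have "\<dots> \<longleftrightarrow> (\<exists>n::int. x - y = of_int n)"
  proof -
    have "2 * pi * x = 2 * pi * y + 2 * pi * of_int n \<longleftrightarrow> x - y = of_int n" for n :: int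
    proof -
      have "2 * pi * x = 2 * pi * y + 2 * pi * of_int n \<longleftrightarrow> 2 * pi * x = 2 * pi * (y + of_int n)"
        by (simp only: distrib_left)
      also have "\<dots> \<longleftrightarrow> x = y + of_int n"
        by simp
      finally show ?thesis by auto
    qed
    then show ?thesis by simp
  qed
  finally show ?thesis by (auto simp: Ints_def)
qed

lemma torus_proj_eq_iff: "torus_proj p = torus_proj q \<longleftrightarrow> p - q \<in> \<int> \<times> \<int>"
  by (cases p; cases q) (simp add: torus_proj_def cis_eq_iff_diff_Ints)

lemma quotient_map_torus_proj: "quotient_map euclidean torus torus_proj"
proof -
  let ?T = "sphere 0 1 \<times> sphere 0 1 :: torus_point set"
  let ?Q = "{0..1} \<times> {0..1} :: plane set"
  have cont: "continuous_on S torus_proj" for S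
    unfolding torus_proj_def by (intro continuous_intros)
  have sub: "range torus_proj \<subseteq> ?T"
    by (auto simp: torus_proj_def)
  have circ: "\<exists>t\<in>{0..1}. z = cis (2 * pi * t)" if "z \<in> sphere 0 1" for z :: complex
  proof -
    define t where "t = Arg2pi z"
    have "norm z = 1" using that by simp
    then have t: "z = cis t"
      unfolding t_def cis_conv_exp by (metis Arg2pi_eq mult_1 of_real_1)
    have "0 \<le> t" "t < 2 * pi"
      unfolding t_def by (rule Arg2pi_ge_0 Arg2pi_lt_2pi)+
    then have "t / (2 * pi) \<in> {0..1}"
      by simp
    moreover have "2 * pi * (t / (2 * pi)) = t"
      by simp
    then have "z = cis (2 * pi * (t / (2 * pi)))"
      using t by metis
    ultimately show ?thesis by blast
  qed
  have img: "torus_proj ` ?Q = ?T"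
  proof
    show "?T \<subseteq> torus_proj ` ?Q"
    proof clarify
      fix a b :: complex assume "a \<in> sphere 0 1" "b \<in> sphere 0 1"
      then obtain s t where "s \<in> {0..1}" "t \<in> {0..1}" "a = cis (2 * pi * s)" "b = cis (2 * pi * t)"
        using circ by meson
      then show "(a, b) \<in> torus_proj ` ?Q"
        by (intro image_eqI[of _ _ "(s, t)"]) (auto simp: torus_proj_def)
    qed
  qed (use sub in auto)
  have quot: "closed U" if U: "U \<subseteq> ?T" "closed (torus_proj -` U)" for U
  proof -
    have "compact (?Q \<inter> torus_proj -` U)"
      by (intro compact_Int_closed compact_Times U) auto
    then have "compact (torus_proj ` (?Q \<inter> torus_proj -` U))"
      by (rule compact_continuous_image[OF cont])
    moreover have "torus_proj ` (?Q \<inter> torus_proj -` U) = U"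
    proof -
      have "f ` (Q \<inter> f -` U) = U" if "f ` Q = T" "U \<subseteq> T"
        for f :: "plane \<Rightarrow> torus_point" and Q T
        using that by auto
      from this[OF img U(1)] show ?thesis .
    qed
    ultimately show ?thesis
      by (simp add: compact_imp_closed)
  qed
  have vim: "closed (torus_proj -` U)" if "closed U" for U
    using cont[of UNIV] that by (simp add: continuous_on_closed_vimage)
  have "closedin torus U \<longleftrightarrow> closed U" if "U \<subseteq> ?T" for U
    using that closedin_closed_eq[of ?T U] by (simp add: torus_def closed_Times)
  moreover have "topspace torus = ?T"
    by (simp add: torus_def)
  moreover have "torus_proj ` UNIV = ?T"
    by (rule subset_antisym[OF sub]) (subst img[symmetric], rule image_mono, rule subset_UNIV)
  ultimately show ?thesis
    unfolding quotient_map_closedin using quot vim by (auto simp: vimage_def)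
qed

definition torus_vertices :: "plane set \<Rightarrow> torus_point set" where
  "torus_vertices V = torus_proj ` V"

definition torus_edges :: "plane set set \<Rightarrow> torus_point set set" where
  "torus_edges E = (\<lambda>e. torus_proj ` e) ` E"

text \<open>
  A closed edge contains exactly its end points among the vertices, so a vertex is covered by an
  edge iff it lies on it.
\<close>

definition perfect_matchings :: "'a set \<Rightarrow> 'a set set \<Rightarrow> 'a set set set" where
  "perfect_matchings V E = {M. M \<subseteq> E \<and> (\<forall>v\<in>V. \<exists>!e. e \<in> M \<and> v \<in> e)}"

text \<open>
  A lift to the plane of an edge of the torus graph, parametrised from its white to its black end.
  Any two choices differ by a translation and an orientation-preserving reparametrisation.
\<close>

definition edge_lift ::
    "plane set set \<Rightarrow> plane set \<Rightarrow> plane set \<Rightarrow> torus_point set \<Rightarrow> real \<Rightarrow> plane" where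
  "edge_lift E W B e = (SOME g. arc g \<and> path_image g \<in> E \<and> torus_proj ` path_image g = e \<and>
                                pathstart g \<in> W \<and> pathfinish g \<in> B)"

text \<open>
  The singular 1-simplex traversing the projection of a plane path; the coordinate \<open>x 1\<close> runs from
  0 to 1 from the initial to the final vertex of the standard simplex.
\<close>

definition projected_simplex :: "(real \<Rightarrow> plane) \<Rightarrow> (nat \<Rightarrow> real) \<Rightarrow> torus_point" where
  "projected_simplex g = restrict (\<lambda>x. torus_proj (g (x 1))) (standard_simplex 1)"

definition transition_cycle ::
    "plane set set \<Rightarrow> plane set \<Rightarrow> plane set \<Rightarrow> torus_point set set \<Rightarrow> torus_point set set
      \<Rightarrow> torus_point chain" where
  "transition_cycle E W B \<omega>0 \<omega> =
     (\<Sum>e \<in> \<omega> - \<omega>0. frag_of (projected_simplex (edge_lift E W B e))) -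
     (\<Sum>e \<in> \<omega>0 - \<omega>. frag_of (projected_simplex (edge_lift E W B e)))"

abbreviation H1_torus :: "torus_point chain set monoid" where
  "H1_torus \<equiv> homology_group 1 torus"

abbreviation homology_class :: "torus_point chain \<Rightarrow> torus_point chain set" where
  "homology_class c \<equiv> homologous_rel_set 1 torus {} c"

text \<open>
  The standard basis of the first homology group: the classes of the images of the segments from
  the origin to \<open>(1, 0)\<close> and to \<open>(0, 1)\<close>.
\<close>

definition torus_gen1 :: "torus_point chain set" where
  "torus_gen1 = homology_class (frag_of (projected_simplex (linepath (0, 0) (1, 0))))"

definition torus_gen2 :: "torus_point chain set" where
  "torus_gen2 = homology_class (frag_of (projected_simplex (linepath (0, 0) (0, 1))))"

text \<open>The coordinates, in that basis, of the homology class of the transition cycle.\<close>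

definition homology_type ::
    "plane set set \<Rightarrow> plane set \<Rightarrow> plane set \<Rightarrow> torus_point set set \<Rightarrow> torus_point set set
      \<Rightarrow> int \<times> int" where
  "homology_type E W B \<omega>0 \<omega> =
     (THE (m, n). homology_class (transition_cycle E W B \<omega>0 \<omega>) =
        torus_gen1 [^]\<^bsub>H1_torus\<^esub> (m :: int) \<otimes>\<^bsub>H1_torus\<^esub> torus_gen2 [^]\<^bsub>H1_torus\<^esub> (n :: int))"

definition lattice_point :: "int \<times> int \<Rightarrow> plane" where
  "lattice_point k = (of_int (fst k), of_int (snd k))"

definition homology_types ::
    "plane set \<Rightarrow> plane set set \<Rightarrow> plane set \<Rightarrow> plane set \<Rightarrow> torus_point set set \<Rightarrow> plane set" where
  "homology_types V E W B \<omega>0 =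
     {lattice_point (homology_type E W B \<omega>0 \<omega>) |\<omega>.
        \<omega> \<in> perfect_matchings (torus_vertices V) (torus_edges E)}"

definition newton_polygon ::
    "plane set \<Rightarrow> plane set set \<Rightarrow> plane set \<Rightarrow> plane set \<Rightarrow> torus_point set set \<Rightarrow> plane set" where
  "newton_polygon V E W B \<omega>0 = convex hull (homology_types V E W B \<omega>0)"

end

theory Submission
  imports Defs "HOL-Complex_Analysis.Complex_Analysis"
begin

text \<open>
  A point \<open>p\<close> of the polygon is the flux of a fractional perfect matching \<open>x\<close> of the torus graph.
  Choose \<open>x\<close> with the fewest non-integral edges, and let \<open>N\<close> be the set of these edges. By
  minimality, a real flow on \<open>N\<close> is determined by its flux, so the space of such flows has
  dimension at most two. An edge of \<open>N\<close> is not a bridge of \<open>N\<close>, since the vertex sums of \<open>x\<close> are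
  integers; hence \<open>x\<close> is an integral vector plus \<open>t\<^sub>1 g\<^sub>1 + t\<^sub>2 g\<^sub>2\<close>, where \<open>g\<^sub>1\<close> and \<open>g\<^sub>2\<close> are flows of
  closed walks in \<open>N\<close> (the second may be absent). If \<open>p\<close> is a lattice point, then
  \<open>a = t\<^sub>1 h\<^sub>1 + t\<^sub>2 h\<^sub>2\<close> is one too, for the homology classes \<open>h\<^sub>i\<close> of \<open>g\<^sub>i\<close>. Now planarity enters: a periodic
  curve in direction \<open>h\<^sub>1\<close> meets every periodic curve in a transverse direction \<open>h\<^sub>2\<close> (Brouwer), and
  also its own translate by a fraction of \<open>h\<^sub>1\<close> (Fashoda). As the graph is embedded, the lifted walks
  then share a vertex with their translates by \<open>a\<close>, so some closed walk in \<open>N\<close> has class \<open>a\<close>. Its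
  integral flow equals \<open>t\<^sub>1 g\<^sub>1 + t\<^sub>2 g\<^sub>2\<close>, so \<open>t\<^sub>1\<close> is an integer, and \<open>N\<close> is empty.
\<close>

section \<open>Periodic plane curves\<close>

text \<open>The translates of \<open>p\<close> by the multiples of \<open>h\<close> fit end to end,
  because \<open>p\<close> itself advances by \<open>h\<close>; \<open>c\<close> runs through them,
  one per unit of time.\<close>

lemma periodic_extension_of_path:
  fixes p :: "real \<Rightarrow> 'a::real_normed_vector"
  assumes p: "path p"
    and h_def: "h = pathfinish p - pathstart p"
  shows "\<exists>c :: real \<Rightarrow> _. continuous_on UNIV c \<and> (\<forall>s. c (s + 1) = c s + h) \<and>
    (\<forall>s. \<exists>k::int. c s \<in> (+) (of_int k *\<^sub>R h) ` path_image p)"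
proof -
  define c where "c s = of_int \<lfloor>s\<rfloor> *\<^sub>R h + p (frac s)" for s
  \<comment> \<open>At the right end the floor has already jumped to \<open>k + 1\<close>, but
    \<open>p 1 = p 0 + h\<close> makes both formulas agree, so one formula holds on the closed
    interval.\<close>
  have piece: "c s = of_int k *\<^sub>R h + p (s - of_int k)" if "s \<in> {of_int k..of_int k + 1}" for s k
  proof (cases "s = of_int k + 1")
    case True
    then have "\<lfloor>s\<rfloor> = k + 1" by linarith
    then show ?thesis
      using True by (simp add: c_def frac_def h_def pathfinish_def pathstart_def algebra_simps)
  next
    case False
    then have "\<lfloor>s\<rfloor> = k" using that by (intro floor_unique) auto
    then show ?thesis by (simp add: c_def frac_def)
  qed
  have contpiece: "continuous_on {of_int k..of_int k + 1} c" for k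
  proof -
    have "continuous_on {of_int k..of_int k + 1} (\<lambda>s. of_int k *\<^sub>R h + p (s - of_int k))"
    proof (intro continuous_intros)
      show "continuous_on {of_int k..of_int k + 1} (\<lambda>s. p (s - of_int k))"
        by (rule continuous_on_compose2[OF p[unfolded path_def]]) (auto intro!: continuous_intros)
    qed
    then show ?thesis by (subst continuous_on_cong[OF refl piece]) auto
  qed
  have "isCont c s" for s
  proof -
    define k where "k = \<lfloor>s\<rfloor>"
    have "continuous_on ({of_int (k - 1)..of_int (k - 1) + 1} \<union> {of_int k..of_int k + 1}) c"
      by (intro continuous_on_closed_Un contpiece) auto
    moreover have "{of_int (k - 1)..of_int (k - 1) + 1} \<union> {of_int k..of_int k + 1} = {of_int k - 1..of_int k + 1 :: real}"
      by auto
    ultimately have "continuous_on {of_int k - 1..of_int k + 1} c" by simp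
    moreover have "s \<in> interior {of_int k - 1..of_int k + 1}"
      unfolding k_def interior_atLeastAtMost_real greaterThanLessThan_iff by linarith
    ultimately show ?thesis by (rule continuous_on_interior)
  qed
  then have "continuous_on UNIV c" by (simp add: continuous_at_imp_continuous_on)
  moreover have "c (s + 1) = c s + h" for s
    by (simp add: c_def frac_def algebra_simps)
  moreover have "\<exists>k::int. c s \<in> (+) (of_int k *\<^sub>R h) ` path_image p" for s
    unfolding c_def path_image_def using frac_ge_0[of s] frac_lt_1[of s]
    by (intro exI[of _ "\<lfloor>s\<rfloor>"]) auto
  ultimately show ?thesis by blast
qed

text \<open>The deviation from uniform motion along \<open>h\<close> has period 1, so a bound on
  \<open>{0..1}\<close> holds everywhere.\<close>

lemma periodic_extension_bounded:
  fixes c :: "real \<Rightarrow> 'a::real_normed_vector"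
  assumes "continuous_on UNIV c" and "\<And>s. c (s + 1) = c s + h"
  obtains M where "\<And>s. norm (c s - s *\<^sub>R h) \<le> M"
proof -
  have int: "c (s + of_nat n) = c s + of_nat n *\<^sub>R h" for s n
  proof (induction n)
    case (Suc n)
    have "c (s + of_nat (Suc n)) = c ((s + of_nat n) + 1)" by (simp add: ac_simps)
    also have "\<dots> = c s + of_nat n *\<^sub>R h + h" using assms(2) Suc by simp
    finally show ?case by (simp add: algebra_simps)
  qed simp
  have per: "c (s + of_int k) = c s + of_int k *\<^sub>R h" for s k
  proof (cases "k \<ge> 0")
    case True
    then show ?thesis using int[of s "nat k"] by simp
  next
    case False
    then show ?thesis using int[of "s + of_int k" "nat (-k)"] by simp
  qed
  have "compact ((\<lambda>s. c s - s *\<^sub>R h) ` {0..1})"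
    by (intro compact_continuous_image continuous_intros continuous_on_subset[OF assms(1)]) auto
  then have "bounded ((\<lambda>s. c s - s *\<^sub>R h) ` {0..1})" by (rule compact_imp_bounded)
  then obtain M where M: "\<And>s. s \<in> {0..1} \<Longrightarrow> norm (c s - s *\<^sub>R h) \<le> M"
    unfolding bounded_iff by blast
  have "norm (c s - s *\<^sub>R h) \<le> M" for s
  proof -
    have "c s - s *\<^sub>R h = c (frac s) - frac s *\<^sub>R h"
      using per[of "frac s" "\<lfloor>s\<rfloor>"] by (simp add: frac_def algebra_simps)
    then show ?thesis using M[of "frac s"] frac_ge_0[of s] frac_lt_1[of s] by (simp add: less_imp_le)
  qed
  then show ?thesis using that by blast
qed

definition det2 :: "plane \<Rightarrow> plane \<Rightarrow> real" where
  "det2 u v = fst u * snd v - snd u * fst v"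

lemma det2_cramer: "det2 u v *\<^sub>R z = det2 z v *\<^sub>R u + det2 u z *\<^sub>R v"
  by (cases u; cases v; cases z) (simp add: det2_def algebra_simps)

text \<open>The extended curves meet where \<open>s *\<^sub>R h1 - t *\<^sub>R h2 = d s t\<close>,
  with \<open>d\<close> bounded. As \<open>h1\<close> and \<open>h2\<close> are independent, this is
  a fixed point equation for a bounded continuous map of the plane, and Brouwer's theorem
  applies.\<close>

lemma periodic_paths_cross:
  fixes p1 p2 :: "real \<Rightarrow> plane"
  assumes "path p1" "path p2"
    and h1: "h1 = pathfinish p1 - pathstart p1" and h2: "h2 = pathfinish p2 - pathstart p2"
    and det: "det2 h1 h2 \<noteq> 0"
  obtains k l :: int where
    "(+) (of_int k *\<^sub>R h1) ` path_image p1 \<inter> (+) (of_int l *\<^sub>R h2) ` path_image p2 \<noteq> {}"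
proof -
  obtain c1 :: "real \<Rightarrow> plane" where c1: "continuous_on UNIV c1" "\<And>s. c1 (s + 1) = c1 s + h1"
    "\<And>s. \<exists>k::int. c1 s \<in> (+) (of_int k *\<^sub>R h1) ` path_image p1"
    using periodic_extension_of_path[OF \<open>path p1\<close> h1] by auto
  obtain c2 :: "real \<Rightarrow> plane" where c2: "continuous_on UNIV c2" "\<And>s. c2 (s + 1) = c2 s + h2"
    "\<And>s. \<exists>k::int. c2 s \<in> (+) (of_int k *\<^sub>R h2) ` path_image p2"
    using periodic_extension_of_path[OF \<open>path p2\<close> h2] by auto
  obtain M1 where M1: "\<And>s. norm (c1 s - s *\<^sub>R h1) \<le> M1"
    using periodic_extension_bounded[OF c1(1,2)] by blast
  obtain M2 where M2: "\<And>s. norm (c2 s - s *\<^sub>R h2) \<le> M2"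
    using periodic_extension_bounded[OF c2(1,2)] by blast
  define d where "d s t = (c2 t - t *\<^sub>R h2) - (c1 s - s *\<^sub>R h1)" for s t
  \<comment> \<open>Cramer's rule for the unknowns \<open>s\<close> and \<open>t\<close>: a fixed
    point of \<open>f\<close> is a pair of parameters at which the two curves meet.\<close>
  define f where "f z = (det2 (d (fst z) (snd z)) h2 / det2 h1 h2, - det2 h1 (d (fst z) (snd z)) / det2 h1 h2)" for z
  have contd: "continuous_on UNIV (\<lambda>z. d (fst z) (snd z))"
    unfolding d_def
    by (intro continuous_intros continuous_on_compose2[OF c1(1)] continuous_on_compose2[OF c2(1)]) auto
  have contf: "continuous_on UNIV f"
    unfolding f_def det2_def by (intro continuous_intros contd) (use det in \<open>auto simp: det2_def\<close>)
  have nd: "norm (d s t) \<le> M2 + M1" for s t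
    unfolding d_def by (rule order_trans[OF norm_triangle_ineq4]) (intro add_mono M1 M2)
  have "bounded (range (\<lambda>z. d (fst z) (snd z)))"
    using nd by (auto simp: bounded_iff)
  then have "compact (closure (range (\<lambda>z. d (fst z) (snd z))))" by simp
  then have "compact ((\<lambda>w. (det2 w h2 / det2 h1 h2, - det2 h1 w / det2 h1 h2)) ` closure (range (\<lambda>z. d (fst z) (snd z))))"
    unfolding det2_def
    by (intro compact_continuous_image continuous_intros) (use det in \<open>auto simp: det2_def\<close>)
  moreover have "range f \<subseteq> (\<lambda>w. (det2 w h2 / det2 h1 h2, - det2 h1 w / det2 h1 h2)) ` closure (range (\<lambda>z. d (fst z) (snd z)))"
  proof -
    have "range f = (\<lambda>w. (det2 w h2 / det2 h1 h2, - det2 h1 w / det2 h1 h2)) ` range (\<lambda>z. d (fst z) (snd z))"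
      unfolding f_def image_image by simp
    then show ?thesis by (simp only: image_mono[OF closure_subset])
  qed
  ultimately have "bounded (range f)"
    by (rule bounded_subset[OF compact_imp_bounded])
  then obtain M where M: "\<And>z. f z \<in> cball 0 M"
    by (auto simp: bounded_iff)
  obtain z where z: "f z = z"
  proof (rule brouwer[of "cball 0 M" f])
    show "cball 0 M \<noteq> ({} :: plane set)" using M by blast
    show "continuous_on (cball 0 M) f" using contf continuous_on_subset by blast
  qed (use M in auto)
  define s t where "s = fst z" and "t = snd z"
  have "s = det2 (d s t) h2 / det2 h1 h2" "t = - det2 h1 (d s t) / det2 h1 h2"
    using z unfolding f_def s_def t_def by (metis fst_conv, metis snd_conv)
  then have st: "det2 (d s t) h2 = det2 h1 h2 * s" "det2 h1 (d s t) = - det2 h1 h2 * t"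
    using det by (simp_all add: field_simps)
  have "det2 h1 h2 *\<^sub>R d s t = det2 h1 h2 *\<^sub>R (s *\<^sub>R h1 - t *\<^sub>R h2)"
    unfolding det2_cramer[of h1 h2 "d s t"] st by (simp add: algebra_simps)
  then have "d s t = s *\<^sub>R h1 - t *\<^sub>R h2" using det by simp
  then have "c1 s = c2 t" by (simp add: d_def algebra_simps)
  moreover obtain k :: int where "c1 s \<in> (+) (of_int k *\<^sub>R h1) ` path_image p1" using c1(3) by blast
  moreover obtain l :: int where "c2 t \<in> (+) (of_int l *\<^sub>R h2) ` path_image p2" using c2(3) by blast
  ultimately show ?thesis by (intro that[of k l]) auto
qed

text \<open>One period is cut off between two points of least height across \<open>h\<close>. Its
  translate by a proper fraction of \<open>h\<close> begins and ends at the same height, and the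
  four end points interlace along the bottom of a box, which forces a crossing (Fashoda).\<close>

lemma periodic_path_meets_translate:
  fixes p :: "real \<Rightarrow> plane"
  assumes "path p" and h: "h = pathfinish p - pathstart p" and "h \<noteq> 0" "0 < t" "t < 1"
  obtains k l :: int where
    "(+) (of_int k *\<^sub>R h) ` path_image p \<inter> (+) (t *\<^sub>R h + of_int l *\<^sub>R h) ` path_image p \<noteq> {}"
proof -
  obtain c :: "real \<Rightarrow> plane" where c: "continuous_on UNIV c" "\<And>s. c (s + 1) = c s + h"
    "\<And>s. \<exists>k::int. c s \<in> (+) (of_int k *\<^sub>R h) ` path_image p"
    using periodic_extension_of_path[OF \<open>path p\<close> h] by auto
  \<comment> \<open>Coordinates along and across \<open>h\<close>: the first orders the end points,
    the second measures height.\<close>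
  define T :: "plane \<Rightarrow> real^2" where "T z = vector [h \<bullet> z, det2 h z]" for z
  have T1: "T z $ 1 = h \<bullet> z" and T2: "T z $ 2 = det2 h z" for z
    by (simp_all add: T_def)
  have T_add: "T (y + z) = T y + T z" and T_scale: "T (r *\<^sub>R z) = r *\<^sub>R T z" for y z r
    unfolding vec_eq_iff forall_2
    by (simp_all add: T1 T2 inner_add_right, simp_all add: det2_def algebra_simps)
  have "linear T" by (rule linearI) (simp_all add: T_add T_scale)
  then have contT: "continuous_on S T" for S
    by (simp add: linear_continuous_on linear_linear)
  have hh: "h \<bullet> h > 0" "det2 h h = 0"
    using \<open>h \<noteq> 0\<close> by (simp_all add: det2_def)
  have T_inj: "y = z" if "T y = T z" for y z
  proof -
    have "h \<bullet> (y - z) = 0" "det2 h (y - z) = 0"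
      using that T1[of y] T1[of z] T2[of y] T2[of z]
      by (simp_all add: inner_diff_right, simp add: det2_def algebra_simps)
    then have "(h \<bullet> h) * fst (y - z) = 0" "(h \<bullet> h) * snd (y - z) = 0"
    proof -
      \<comment> \<open>In complex notation the two hypotheses say that the conjugate of
        \<open>a + \<i> * b\<close> times \<open>x + \<i> * y\<close> vanishes; multiplying by
        \<open>a + \<i> * b\<close> gives the claim.\<close>
      have "(a * a + b * b) * x = 0 \<and> (a * a + b * b) * y = 0"
        if "a * x + b * y = 0" "a * y - b * x = 0" for a b x y :: real
      proof -
        have "(a * a + b * b) * x = a * (a * x + b * y) - b * (a * y - b * x)"
          "(a * a + b * b) * y = b * (a * x + b * y) + a * (a * y - b * x)"
          by (simp_all add: algebra_simps)
        then show ?thesis using that by simp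
      qed
      from this[of "fst h" "fst (y - z)" "snd h" "snd (y - z)"]
      show "(h \<bullet> h) * fst (y - z) = 0" "(h \<bullet> h) * snd (y - z) = 0"
        using \<open>h \<bullet> (y - z) = 0\<close> \<open>det2 h (y - z) = 0\<close>
        unfolding det2_def inner_prod_def inner_real_def by blast+
    qed
    then show ?thesis using hh by (auto simp: prod_eq_iff)
  qed
  \<comment> \<open>Starting the period at a point of least height keeps the whole curve above the
    level of its two ends.\<close>
  have "continuous_on {0..1} (\<lambda>s. det2 h (c s))"
    unfolding det2_def by (intro continuous_intros continuous_on_subset[OF c(1)]) auto
  then obtain s0 where s0: "s0 \<in> {0..1}" "\<forall>s\<in>{0..1}. det2 h (c s0) \<le> det2 h (c s)"
    using continuous_attains_inf[of "{0..1::real}" "\<lambda>s. det2 h (c s)"] by auto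
  have per: "det2 h (c (s + 1)) = det2 h (c s)" for s
    unfolding c(2) using hh by (simp add: det2_def algebra_simps)
  have min: "det2 h (c s0) \<le> det2 h (c s)" if "s \<in> {s0..s0 + 1}" for s
  proof (cases "s \<le> 1")
    case True then show ?thesis using s0 that by auto
  next
    case False
    then have "s - 1 \<in> {0..1}" using s0 that by auto
    then show ?thesis using s0 per[of "s - 1"] by auto
  qed
  define f where "f s = T (c (s0 + s))" for s
  define g where "g s = T (t *\<^sub>R h) + f s" for s
  have pf: "path f"
    unfolding path_def f_def
    by (intro continuous_on_compose2[OF contT[of UNIV]] continuous_on_compose2[OF c(1)] continuous_intros) auto
  then have pg: "path g"
    unfolding path_def g_def by (intro continuous_intros)
  have f01: "pathstart f = T (c s0)" "pathfinish f = T (c s0) + T h"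
    "pathstart g = T (c s0) + t *\<^sub>R T h" "pathfinish g = T (c s0) + T h + t *\<^sub>R T h"
    by (simp_all add: pathstart_def pathfinish_def g_def f_def c(2) T_add T_scale)
  have "bounded (path_image f \<union> path_image g)"
    using pf pg by (simp add: bounded_path_image)
  then obtain M where M: "path_image f \<union> path_image g \<subseteq> cbox (- M) M"
    using bounded_subset_cbox_symmetric by blast
  \<comment> \<open>The bottom of the box lies at the least height, so that all four end points are
    on it.\<close>
  define a b where "a = (vector [- M $ 1, det2 h (c s0)] :: real^2)" and "b = (vector [M $ 1, M $ 2] :: real^2)"
  have boxI: "x \<in> cbox a b" if "x \<in> path_image f \<union> path_image g" "det2 h (c s0) \<le> x $ 2" for x :: "real^2"
    using that M unfolding a_def b_def by (auto simp: mem_box_cart forall_2)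
  have flow: "det2 h (c s0) \<le> f s $ 2" and glow: "det2 h (c s0) \<le> g s $ 2" if "s \<in> {0..1}" for s
    using that min[of "s0 + s"] hh by (simp_all add: g_def f_def T_scale T1 T2)
  have "path_image f \<subseteq> cbox a b" "path_image g \<subseteq> cbox a b"
    using flow glow by (auto intro!: boxI simp: path_image_def)
  then obtain z where z: "z \<in> path_image f" "z \<in> path_image g"
  proof (rule fashoda_interlace[OF pf pg])
  qed (use hh \<open>0 < t\<close> \<open>t < 1\<close> in \<open>auto simp: f01 a_def T1 T2\<close>)
  then obtain s r where sr: "T (c (s0 + s)) = T (t *\<^sub>R h + c (s0 + r))"
    unfolding path_image_def g_def f_def by (auto simp: T_add)
  then have eq: "c (s0 + s) = t *\<^sub>R h + c (s0 + r)" by (rule T_inj)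
  obtain k :: int where k: "c (s0 + s) \<in> (+) (of_int k *\<^sub>R h) ` path_image p" using c(3) by blast
  obtain l :: int where "c (s0 + r) \<in> (+) (of_int l *\<^sub>R h) ` path_image p" using c(3) by blast
  then have "c (s0 + s) \<in> (+) (t *\<^sub>R h + of_int l *\<^sub>R h) ` path_image p"
    unfolding eq by (auto simp: add.assoc)
  with k show ?thesis by (intro that[of k l]) blast
qed

section \<open>The first homology group of the torus\<close>

declare One_nat_def [simp del]

section \<open>Singular 1-simplices of paths\<close>

lemma continuous_map_coordinate_standard_simplex:
  "continuous_map (subtopology (powertop_real UNIV) (standard_simplex 1)) (top_of_set {0..1}) (\<lambda>x. x 1)"
  unfolding continuous_map_in_subtopology
  by (auto simp: standard_simplex_def intro!: continuous_map_from_subtopology continuous_map_product_projection)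

text \<open>The counterpart of \<open>projected_simplex\<close> before projection, so that chains
  can be compared in the plane and then pushed to the torus.\<close>

definition path_simplex :: "(real \<Rightarrow> 'a) \<Rightarrow> (nat \<Rightarrow> real) \<Rightarrow> 'a" where
  "path_simplex g = restrict (\<lambda>x. g (x 1)) (standard_simplex 1)"

lemma singular_simplex_path_simplex:
  assumes "path g"
  shows "singular_simplex 1 euclidean (path_simplex g)"
proof -
  have "continuous_map (top_of_set {0..1}) euclidean g"
    using assms by (simp add: path_def)
  from continuous_map_compose[OF continuous_map_coordinate_standard_simplex this]
  have "continuous_map (subtopology (powertop_real UNIV) (standard_simplex 1)) euclidean (\<lambda>x. g (x 1))"
    by (simp add: o_def)
  then show ?thesis
    unfolding singular_simplex_def path_simplex_def
    by (auto intro: continuous_map_eq)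
qed

lemma chain_boundary_path_simplex:
  "chain_boundary 1 (frag_of (path_simplex g)) =
     frag_of (restrict (\<lambda>_. pathfinish g) (standard_simplex 0)) -
     frag_of (restrict (\<lambda>_. pathstart g) (standard_simplex 0))"
proof -
  \<comment> \<open>Face 0 omits the initial vertex of the simplex and hence sits at the final point
    of \<open>g\<close>; face 1 sits at the initial point.\<close>
  have face: "singular_face 1 k (path_simplex g) = restrict (\<lambda>_. g (if k = 0 then 1 else 0)) (standard_simplex 0)"
    if "k \<le> 1" for k
  proof
    fix x
    show "singular_face 1 k (path_simplex g) x = restrict (\<lambda>_. g (if k = 0 then 1 else 0)) (standard_simplex 0) x"
    proof (cases "x \<in> standard_simplex 0")
      case True
      then have "simplical_face k x \<in> standard_simplex 1"
        using simplical_face_in_standard_simplex[of 1 k x] that by (simp add: One_nat_def)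
      moreover have "simplical_face k x 1 = (if k = 0 then 1 else 0)"
        using True that by (auto simp: standard_simplex_0 simplical_face_def)
      ultimately show ?thesis
        using True by (simp add: singular_face_def path_simplex_def One_nat_def)
    qed (simp add: singular_face_def One_nat_def)
  qed
  have "chain_boundary 1 (frag_of (path_simplex g)) =
      (\<Sum>k\<le>Suc 0. frag_cmul ((-1) ^ k) (frag_of (singular_face 1 k (path_simplex g))))"
    by (simp add: chain_boundary_of flip: One_nat_def)
  also have "\<dots> = frag_of (singular_face 1 0 (path_simplex g)) - frag_of (singular_face 1 1 (path_simplex g))"
    by (simp add: One_nat_def)
  finally show ?thesis
    using face[of 0] face[of 1] by (simp add: pathfinish_def pathstart_def)
qed

lemma projected_simplex_eq: "projected_simplex g = simplex_map 1 torus_proj (path_simplex g)"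
  by (auto simp: projected_simplex_def simplex_map_def path_simplex_def fun_eq_iff)

text \<open>The plane is contractible, so its first homology group is trivial.\<close>

lemma singular_cycle_euclidean_imp_boundary:
  fixes c :: "(real \<times> real) chain"
  assumes "singular_relcycle 1 euclidean {} c"
  shows "singular_relboundary 1 euclidean {} c"
proof -
  have "contractible_space (top_of_set (UNIV :: plane set))"
    by (simp only: contractible_space_top_of_set convex_imp_contractible convex_UNIV)
  then have "trivial_group (reduced_homology_group 1 (euclidean :: plane topology))"
    by (intro trivial_reduced_homology_group_contractible_space) simp
  then have "carrier (homology_group (int 1) (euclidean :: plane topology)) = {singular_relboundary_set 1 euclidean {}}"
    by (simp add: un_reduced_homology_group trivial_group_def flip: one_relative_homology_group)
  moreover have "homologous_rel_set 1 euclidean {} c \<in> carrier (homology_group (int 1) (euclidean :: plane topology))"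
    unfolding carrier_relative_homology_group using assms by (intro imageI) simp
  ultimately have "homologous_rel_set 1 euclidean {} c = singular_relboundary_set 1 euclidean {}"
    by (simp only: singleton_iff)
  then show ?thesis by (simp add: homologous_rel_set_eq_relboundary)
qed

section \<open>Projected paths up to homology\<close>

lemma continuous_map_torus_proj: "continuous_map euclidean torus torus_proj"
  using quotient_map_torus_proj quotient_imp_continuous_map by blast

text \<open>A reference path to each point, which lets every projected path be replaced by a
  difference depending only on its end points.\<close>

definition radial_chain :: "plane \<Rightarrow> torus_point chain" where
  "radial_chain u = frag_of (projected_simplex (linepath 0 u))"

text \<open>In the plane, \<open>g\<close> and the two segments from the origin to its ends form a
  cycle, which bounds; the projection carries this to the torus.\<close>

lemma homologous_projected_simplex:
  assumes "path g"
  shows "homologous_rel 1 torus {} (frag_of (projected_simplex g))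
           (radial_chain (pathfinish g) - radial_chain (pathstart g))"
proof -
  let ?c = "frag_of (path_simplex g) - (frag_of (path_simplex (linepath 0 (pathfinish g))) -
              frag_of (path_simplex (linepath 0 (pathstart g))))"
  have "singular_relcycle 1 euclidean {} ?c"
    unfolding singular_cycle
    using assms
    by (auto simp: chain_boundary_diff chain_boundary_path_simplex singular_chain_of
        intro!: singular_chain_diff singular_simplex_path_simplex)
  then have "singular_relboundary 1 torus {} (chain_map 1 torus_proj ?c)"
    using singular_cycle_euclidean_imp_boundary singular_relboundary_chain_map continuous_map_torus_proj
    by blast
  then show ?thesis
    by (simp add: homologous_rel_def radial_chain_def chain_map_diff projected_simplex_eq)
qed

lemma torus_proj_add_Ints: "a \<in> \<int> \<times> \<int> \<Longrightarrow> torus_proj (a + z) = torus_proj z"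
  by (simp add: torus_proj_eq_iff)

text \<open>Translating the segment from the origin to \<open>u\<close> by a lattice vector leaves
  its projection unchanged, while the translated path runs from \<open>a\<close> to
  \<open>a + u\<close>.\<close>

lemma radial_chain_add:
  assumes "a \<in> \<int> \<times> \<int>"
  shows "homologous_rel 1 torus {} (radial_chain (a + u)) (radial_chain a + radial_chain u)"
proof -
  have "projected_simplex (\<lambda>t. a + linepath 0 u t) = projected_simplex (linepath 0 u)"
    by (simp add: projected_simplex_def torus_proj_add_Ints[OF assms])
  moreover have "path (\<lambda>t. a + linepath 0 u t)"
    by (intro path_continuous_image[unfolded o_def, of "linepath 0 u" "\<lambda>z. a + z"] continuous_intros) simp
  ultimately have "homologous_rel 1 torus {} (radial_chain u) (radial_chain (a + u) - radial_chain a)"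
    using homologous_projected_simplex[of "\<lambda>t. a + linepath 0 u t"]
    by (simp add: radial_chain_def pathfinish_def pathstart_def linepath_def)
  then have "homologous_rel 1 torus {} (radial_chain a + radial_chain u) (radial_chain a + (radial_chain (a + u) - radial_chain a))"
    by (intro homologous_rel_add homologous_rel_refl)
  then show ?thesis by (simp add: homologous_rel_sym)
qed

definition torus_chain :: "int \<times> int \<Rightarrow> torus_point chain" where
  "torus_chain k = frag_cmul (fst k) (radial_chain (1, 0)) + frag_cmul (snd k) (radial_chain (0, 1))"

lemma torus_chain_add: "torus_chain (k + l) = torus_chain k + torus_chain l"
  by (simp add: torus_chain_def frag_cmul_distrib)

lemma torus_chain_0: "torus_chain 0 = 0"
  by (simp add: torus_chain_def)

lemma torus_chain_diff: "torus_chain (k - l) = torus_chain k - torus_chain l"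
  using torus_chain_add[of "k - l" l] by simp

lemma torus_chain_sum: "torus_chain (sum f I) = (\<Sum>i\<in>I. torus_chain (f i))"
  by (induction I rule: infinite_finite_induct) (simp_all add: torus_chain_0 torus_chain_add)

lemma lattice_point_add: "lattice_point (k + l) = lattice_point k + lattice_point l"
  by (simp add: lattice_point_def)

lemma lattice_point_diff: "lattice_point (k - l) = lattice_point k - lattice_point l"
  by (simp add: lattice_point_def)

lemma lattice_point_sum: "lattice_point (sum f I) = (\<Sum>i\<in>I. lattice_point (f i))"
  by (induction I rule: infinite_finite_induct) (simp_all add: lattice_point_add, simp_all add: lattice_point_def zero_prod_def)

lemma lattice_point_in_Ints: "lattice_point k \<in> \<int> \<times> \<int>"
  by (simp add: lattice_point_def)

lemma homologous_rel_add_cancel: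
  assumes "homologous_rel p X S (a + b) (c + b)"
  shows "homologous_rel p X S a c"
  using assms by (simp add: homologous_rel_def)

text \<open>Additivity on lattice vectors reduces the claim to the two unit vectors, by induction on
  each coordinate.\<close>

lemma radial_chain_lattice_point:
  "homologous_rel 1 torus {} (radial_chain (lattice_point k)) (torus_chain k)"
proof -
  define Q where "Q k \<longleftrightarrow> homologous_rel 1 torus {} (radial_chain (lattice_point k)) (torus_chain k)" for k
  \<comment> \<open>An equivalence, so that the integer induction can go down as well as up.\<close>
  have QI: "homologous_rel 1 torus {} (radial_chain (lattice_point (k + l))) (torus_chain (k + l)) \<longleftrightarrow> Q k"
    if "Q l" for k l
  proof -
    have *: "homologous_rel 1 torus {} (radial_chain (lattice_point (k + l))) (radial_chain (lattice_point k) + torus_chain l)"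
      unfolding lattice_point_add
      by (rule homologous_rel_trans[OF homologous_rel_add[OF homologous_rel_refl that[unfolded Q_def]]
            radial_chain_add[OF lattice_point_in_Ints]])
    show ?thesis
    proof
      assume "Q k"
      then have "homologous_rel 1 torus {} (radial_chain (lattice_point k) + torus_chain l) (torus_chain k + torus_chain l)"
        unfolding Q_def by (intro homologous_rel_add homologous_rel_refl)
      with * show "homologous_rel 1 torus {} (radial_chain (lattice_point (k + l))) (torus_chain (k + l))"
        unfolding torus_chain_add using homologous_rel_trans by blast
    next
      assume "homologous_rel 1 torus {} (radial_chain (lattice_point (k + l))) (torus_chain (k + l))"
      with * have "homologous_rel 1 torus {} (radial_chain (lattice_point k) + torus_chain l) (torus_chain k + torus_chain l)"
        unfolding torus_chain_add using homologous_rel_trans homologous_rel_sym by blast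
      then show "Q k" unfolding Q_def by (rule homologous_rel_add_cancel)
    qed
  qed
  then have step: "Q (k + l) \<longleftrightarrow> Q k" if "Q l" for k l using that Q_def by blast
  have Q10: "Q (1, 0)" and Q01: "Q (0, 1)"
    by (simp_all add: Q_def torus_chain_def lattice_point_def)
  have Q0: "Q (0, 0)" using step[OF Q10, of "(0, 0)"] Q10 by simp
  have Q1: "Q (m, 0)" for m
  proof (induction m rule: int_induct[of _ 0])
    case (step1 i) then show ?case using step[OF Q10, of "(i, 0)"] by simp
  next
    case (step2 i) then show ?case using step[OF Q10, of "(i - 1, 0)"] by simp
  qed (rule Q0)
  have "Q (m, n)" for m n
  proof (induction n rule: int_induct[of _ 0])
    case (step1 i) then show ?case using step[OF Q01, of "(m, i)"] by simp
  next
    case (step2 i) then show ?case using step[OF Q01, of "(m, i - 1)"] by simp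
  qed (rule Q1)
  then show ?thesis by (cases k) (simp add: Q_def)
qed

text \<open>The origin and a lattice point have the same projection, so the segment between them
  closes up on the torus.\<close>

lemma singular_relcycle_radial_chain: "singular_relcycle 1 torus {} (radial_chain (lattice_point l))"
proof -
  have sc: "singular_chain 1 euclidean (frag_of (path_simplex (linepath 0 (lattice_point l))))"
    by (simp add: singular_chain_of singular_simplex_path_simplex)
  have "singular_simplex 1 torus (projected_simplex (linepath 0 (lattice_point l)))"
    unfolding projected_simplex_eq
    by (rule singular_simplex_simplex_map[OF singular_simplex_path_simplex continuous_map_torus_proj]) simp
  moreover have "chain_boundary 1 (radial_chain (lattice_point l)) = 0"
  proof -
    have "chain_boundary 1 (radial_chain (lattice_point l)) =
          chain_boundary 1 (chain_map 1 torus_proj (frag_of (path_simplex (linepath 0 (lattice_point l)))))"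
      by (simp add: radial_chain_def projected_simplex_eq)
    also have "\<dots> = chain_map 0 torus_proj (chain_boundary 1 (frag_of (path_simplex (linepath 0 (lattice_point l)))))"
      using chain_boundary_chain_map[OF sc] by simp
    also have "\<dots> = 0"
      using torus_proj_add_Ints[OF lattice_point_in_Ints[of l], of 0]
      by (simp add: chain_boundary_path_simplex chain_map_diff simplex_map_def restrict_compose_right o_def
          restrict_def cong: if_cong)
    finally show ?thesis .
  qed
  ultimately show ?thesis by (simp add: singular_cycle radial_chain_def singular_chain_of)
qed

lemma singular_relcycle_torus_chain: "singular_relcycle 1 torus {} (torus_chain k)"
  using homologous_rel_singular_relcycle[OF radial_chain_lattice_point] singular_relcycle_radial_chain by blast

lemma homology_class_mult:
  assumes "singular_relcycle 1 torus {} a" "singular_relcycle 1 torus {} b"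
  shows "homology_class a \<otimes>\<^bsub>H1_torus\<^esub> homology_class b = homology_class (a + b)"
proof -
  have "homology_class a \<otimes>\<^bsub>homology_group (int 1) torus\<^esub> homology_class b = homology_class (a + b)"
    unfolding mult_relative_homology_group
  proof safe
    fix x y assume "homologous_rel 1 torus {} a x" "homologous_rel 1 torus {} b y"
    then show "homologous_rel 1 torus {} (a + b) (x + y)" by (rule homologous_rel_add)
  next
    fix z assume "homologous_rel 1 torus {} (a + b) z"
    then have "homologous_rel 1 torus {} b (z - a)"
      unfolding homologous_rel_def by (simp add: algebra_simps)
    then show "z \<in> (\<Union>r\<in>homology_class a. \<Union>s\<in>homology_class b. {r + s})"
      by (intro UN_I[of a] UN_I[of "z - a"]) auto
  qed
  then show ?thesis by simp
qed

text \<open>Connects chains with the group powers in which \<open>homology_type\<close> is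
  expressed.\<close>

lemma homology_class_torus_chain:
  "homology_class (torus_chain k) =
     torus_gen1 [^]\<^bsub>H1_torus\<^esub> fst k \<otimes>\<^bsub>H1_torus\<^esub> torus_gen2 [^]\<^bsub>H1_torus\<^esub> snd k"
proof -
  have G: "group H1_torus" by simp
  have carr: "homology_class (torus_chain l) \<in> carrier H1_torus" for l
    using carrier_relative_homology_group[of 1 torus "{}"] singular_relcycle_torus_chain by auto
  \<comment> \<open>The multiples of a fixed \<open>v\<close> give a homomorphism from the integers,
    whose values are therefore the powers of its value at 1.\<close>
  have hom: "(\<lambda>m::int. homology_class (torus_chain (m * fst v, m * snd v))) \<in> hom integer_group H1_torus" for v
  proof (rule homI)
    fix m n :: int
    have "torus_chain ((m + n) * fst v, (m + n) * snd v)
        = torus_chain (m * fst v, m * snd v) + torus_chain (n * fst v, n * snd v)"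
      by (simp add: torus_chain_add[symmetric] algebra_simps)
    then show "homology_class (torus_chain ((m \<otimes>\<^bsub>integer_group\<^esub> n) * fst v, (m \<otimes>\<^bsub>integer_group\<^esub> n) * snd v)) =
      homology_class (torus_chain (m * fst v, m * snd v)) \<otimes>\<^bsub>H1_torus\<^esub> homology_class (torus_chain (n * fst v, n * snd v))"
      by (simp add: homology_class_mult singular_relcycle_torus_chain)
  qed (rule carr)
  have pow: "homology_class (torus_chain (m * fst v, m * snd v)) = homology_class (torus_chain v) [^]\<^bsub>H1_torus\<^esub> m" for m v
  proof -
    interpret group_hom integer_group H1_torus "\<lambda>m::int. homology_class (torus_chain (m * fst v, m * snd v))"
      by (simp add: group_hom_def group_hom_axioms_def hom)
    show ?thesis using hom_int_pow[of 1 m] by simp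
  qed
  have "torus_gen1 = homology_class (torus_chain (1, 0))" "torus_gen2 = homology_class (torus_chain (0, 1))"
    by (simp_all add: torus_gen1_def torus_gen2_def torus_chain_def radial_chain_def zero_prod_def)
  then have "torus_gen1 [^]\<^bsub>H1_torus\<^esub> fst k = homology_class (torus_chain (fst k, 0))"
    "torus_gen2 [^]\<^bsub>H1_torus\<^esub> snd k = homology_class (torus_chain (0, snd k))"
    using pow[of "fst k" "(1, 0)"] pow[of "snd k" "(0, 1)"] by simp_all
  then show ?thesis
    by (simp add: homology_class_mult singular_relcycle_torus_chain torus_chain_add[symmetric])
qed


section \<open>Independence of the two generators, by winding numbers\<close>

definition segment_point :: "real \<Rightarrow> nat \<Rightarrow> real" where
  "segment_point t i = (if i = 0 then 1 - t else if i = 1 then t else 0)"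

lemma segment_point_in_standard_simplex: "t \<in> {0..1} \<Longrightarrow> segment_point t \<in> standard_simplex 1"
  by (auto simp: segment_point_def standard_simplex_def One_nat_def)

text \<open>Barycentric coordinates: identifies a convex triangle in the plane with the standard
  2-simplex, so that a singular 2-simplex becomes a function on a contractible plane set.\<close>

definition triangle_point :: "plane \<Rightarrow> nat \<Rightarrow> real" where
  "triangle_point z i = (if i = 0 then 1 - fst z - snd z else if i = 1 then fst z else if i = 2 then snd z else 0)"

definition std_triangle :: "plane set" where
  "std_triangle = {z. 0 \<le> fst z \<and> 0 \<le> snd z \<and> fst z + snd z \<le> 1}"

lemma triangle_point_in_standard_simplex: "z \<in> std_triangle \<Longrightarrow> triangle_point z \<in> standard_simplex 2"
  by (auto simp: triangle_point_def std_triangle_def standard_simplex_def numeral_2_eq_2 One_nat_def)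

lemma convex_std_triangle: "convex std_triangle"
proof -
  have "std_triangle = {z. (-1, 0) \<bullet> z \<le> 0} \<inter> {z. (0, -1) \<bullet> z \<le> 0} \<inter> {z. (1, 1) \<bullet> z \<le> 1}"
    by (auto simp: std_triangle_def inner_prod_def)
  then show ?thesis by (elim ssubst) (intro convex_Int convex_halfspace_le)
qed

text \<open>The additive extension of a function on simplices to chains, that is, a cochain with
  complex values.\<close>

definition chain_eval :: "('b \<Rightarrow> complex) \<Rightarrow> ('b \<Rightarrow>\<^sub>0 int) \<Rightarrow> complex" where
  "chain_eval f c = (\<Sum>x\<in>Poly_Mapping.keys c. of_int (Poly_Mapping.lookup c x) * f x)"

lemma chain_eval_superset:
  assumes "finite K" "Poly_Mapping.keys c \<subseteq> K"
  shows "chain_eval f c = (\<Sum>x\<in>K. of_int (Poly_Mapping.lookup c x) * f x)"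
  unfolding chain_eval_def using assms
  by (intro sum.mono_neutral_left) (auto simp: in_keys_iff)

lemma chain_eval_diff: "chain_eval f (a - b) = chain_eval f a - chain_eval f b"
proof -
  let ?K = "Poly_Mapping.keys a \<union> Poly_Mapping.keys b"
  have "finite ?K" "Poly_Mapping.keys (a - b) \<subseteq> ?K" by (simp_all add: keys_diff)
  then show ?thesis
    using chain_eval_superset[of ?K "a - b" f] chain_eval_superset[of ?K a f] chain_eval_superset[of ?K b f]
    by (simp add: lookup_minus left_diff_distrib sum_subtractf)
qed

lemma chain_eval_0: "chain_eval f 0 = 0"
  by (simp add: chain_eval_def)

lemma chain_eval_of: "chain_eval f (frag_of x) = f x"
  by (simp add: chain_eval_def)

lemma chain_eval_add: "chain_eval f (a + b) = chain_eval f a + chain_eval f b"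
  using chain_eval_diff[of f a "- b"] chain_eval_diff[of f 0 b] by (simp add: chain_eval_0)

lemma chain_eval_cmul: "chain_eval f (frag_cmul k a) = of_int k * chain_eval f a"
proof -
  have "chain_eval f (frag_cmul k a) = (\<Sum>x\<in>Poly_Mapping.keys a. of_int (Poly_Mapping.lookup (frag_cmul k a) x) * f x)"
    by (intro chain_eval_superset) (auto simp: keys_cmul)
  then show ?thesis by (simp add: chain_eval_def sum_distrib_left mult.assoc)
qed

text \<open>The path need not be closed: the winding number then still is the change of a logarithm
  divided by \<open>2 * pi * \<i>\<close>.\<close>

definition coordinate_winding :: "(torus_point \<Rightarrow> complex) \<Rightarrow> ((nat \<Rightarrow> real) \<Rightarrow> torus_point) \<Rightarrow> complex" where
  "coordinate_winding f s = winding_number (\<lambda>t. f (s (segment_point t))) 0"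

text \<open>On the triangle the nonvanishing function has a logarithm \<open>G\<close>. Each face
  contributes the difference of \<open>G\<close> at its ends, and the alternating sum telescopes;
  winding is thus a cocycle.\<close>

lemma coordinate_winding_boundary:
  assumes f: "continuous_map torus euclidean f" "\<And>z. z \<in> topspace torus \<Longrightarrow> f z \<noteq> 0"
    and s: "singular_simplex 2 torus s"
  shows "coordinate_winding f (singular_face 2 0 s) - coordinate_winding f (singular_face 2 1 s)
          + coordinate_winding f (singular_face 2 2 s) = 0"
proof -
  have cs: "continuous_map (subtopology (powertop_real UNIV) (standard_simplex 2)) torus s"
    using s by (simp add: singular_simplex_def)
  have "continuous_map (top_of_set std_triangle) (subtopology (powertop_real UNIV) (standard_simplex 2)) triangle_point"
    unfolding continuous_map_in_subtopology continuous_map_componentwise_UNIV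
  proof (intro conjI allI)
    fix i
    show "continuous_map (top_of_set std_triangle) euclideanreal (\<lambda>z. triangle_point z i)"
      unfolding triangle_point_def
      by (cases "i = 0"; cases "i = 1"; cases "i = 2") (auto intro!: continuous_intros)
  qed (auto simp: triangle_point_in_standard_simplex)
  from continuous_map_compose[OF continuous_map_compose[OF this cs] f(1)]
  have cont: "continuous_on std_triangle (\<lambda>z. f (s (triangle_point z)))"
    by (simp add: o_def)
  have nz: "f (s (triangle_point z)) \<noteq> 0" if "z \<in> std_triangle" for z
    using continuous_map_image_subset_topspace[OF cs] triangle_point_in_standard_simplex[OF that]
    by (intro f(2)) auto
  obtain G where G: "continuous_on std_triangle G" "\<And>z. z \<in> std_triangle \<Longrightarrow> f (s (triangle_point z)) = exp (G z)"
    using continuous_logarithm_on_contractible[OF cont convex_imp_contractible[OF convex_std_triangle]] nz by blast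
  have face: "coordinate_winding f (singular_face 2 k s) = (G b - G a) / (2 * of_real pi * \<i>)"
    if ab: "a \<in> std_triangle" "b \<in> std_triangle" and k: "k \<le> 2"
      and eq: "\<And>t. simplical_face k (segment_point t) = triangle_point (linepath a b t)" for a b k
  proof -
    have lin: "linepath a b t \<in> std_triangle" if "t \<in> {0..1}" for t
      using convex_std_triangle ab that linepath_in_path
      by (metis closed_segment_subset subsetD)
    have "coordinate_winding f (singular_face 2 k s) = winding_number (exp \<circ> (G \<circ> linepath a b)) 0"
      unfolding coordinate_winding_def
    proof (rule winding_number_cong)
      fix t :: real assume "0 \<le> t" "t \<le> 1"
      then have t: "t \<in> {0..1}" by simp
      then have "singular_face 2 k s (segment_point t) = s (triangle_point (linepath a b t))"
        using segment_point_in_standard_simplex[OF t] by (simp add: singular_face_def eq One_nat_def)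
      then show "f (singular_face 2 k s (segment_point t)) = (exp \<circ> (G \<circ> linepath a b)) t"
        using G(2)[OF lin[OF t]] by simp
    qed
    also have "\<dots> = (pathfinish (G \<circ> linepath a b) - pathstart (G \<circ> linepath a b)) / (2 * of_real pi * \<i>)"
    proof (rule winding_number_compose_exp)
      have "path_image (linepath a b) \<subseteq> std_triangle" using lin by (auto simp: path_image_def)
      then show "path (G \<circ> linepath a b)"
        using path_continuous_image[of "linepath a b" G] G(1) continuous_on_subset by blast
    qed
    finally show ?thesis by (simp add: pathfinish_def pathstart_def linepath_def)
  qed
  have mem: "(0, 0) \<in> std_triangle" "(1, 0) \<in> std_triangle" "(0, 1) \<in> std_triangle"
    by (auto simp: std_triangle_def)
  have "coordinate_winding f (singular_face 2 0 s) = (G (0, 1) - G (1, 0)) / (2 * of_real pi * \<i>)"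
    by (rule face) (use mem in \<open>auto simp: fun_eq_iff simplical_face_def segment_point_def triangle_point_def linepath_def\<close>)
  moreover have "coordinate_winding f (singular_face 2 1 s) = (G (0, 1) - G (0, 0)) / (2 * of_real pi * \<i>)"
    by (rule face) (use mem in \<open>auto simp: fun_eq_iff simplical_face_def segment_point_def triangle_point_def linepath_def\<close>)
  moreover have "coordinate_winding f (singular_face 2 2 s) = (G (1, 0) - G (0, 0)) / (2 * of_real pi * \<i>)"
    by (rule face) (use mem in \<open>auto simp: fun_eq_iff simplical_face_def segment_point_def triangle_point_def linepath_def\<close>)
  ultimately show ?thesis by (simp add: diff_divide_distrib)
qed

lemma chain_eval_boundary:
  assumes f: "continuous_map torus euclidean f" "\<And>z. z \<in> topspace torus \<Longrightarrow> f z \<noteq> 0"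
    and "singular_chain 2 torus d"
  shows "chain_eval (coordinate_winding f) (chain_boundary 2 d) = 0"
  using assms(3) unfolding singular_chain_def
proof (induction rule: frag_induction)
  case (one s)
  have "chain_boundary 2 (frag_of s) = frag_of (singular_face 2 0 s) - frag_of (singular_face 2 1 s) + frag_of (singular_face 2 2 s)"
    by (simp add: chain_boundary_of numeral_2_eq_2 One_nat_def)
  then show ?case
    using coordinate_winding_boundary[OF f, of s] one by (simp add: chain_eval_add chain_eval_diff chain_eval_of)
qed (simp_all add: chain_eval_0 chain_eval_diff chain_boundary_diff)

lemma chain_eval_homologous:
  assumes f: "continuous_map torus euclidean f" "\<And>z. z \<in> topspace torus \<Longrightarrow> f z \<noteq> 0"
    and "homologous_rel 1 torus {} a b"
  shows "chain_eval (coordinate_winding f) a = chain_eval (coordinate_winding f) b"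
proof -
  have "singular_relboundary 1 torus {} (a - b)" using assms(3) by (simp add: homologous_rel_def)
  then obtain d where "singular_chain 2 torus d" "chain_boundary 2 d = a - b"
    unfolding singular_boundary by (auto simp: numeral_2_eq_2 One_nat_def)
  then show ?thesis using chain_eval_boundary[OF f, of d] by (simp add: chain_eval_diff)
qed

text \<open>The logarithm along the segment is explicit and linear, so the cocycle of a circle
  coordinate returns the real coordinate of the end point.\<close>

lemma coordinate_winding_radial:
  assumes "\<And>z. f (torus_proj z) = exp (2 * of_real pi * \<i> * of_real (r z))" "linear r"
  shows "chain_eval (coordinate_winding f) (radial_chain u) = of_real (r u)"
proof -
  have "chain_eval (coordinate_winding f) (radial_chain u)
      = winding_number (exp \<circ> (\<lambda>t. 2 * of_real pi * \<i> * of_real (t * r u))) 0"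
    unfolding radial_chain_def chain_eval_of coordinate_winding_def
  proof (rule winding_number_cong)
    fix t :: real assume "0 \<le> t" "t \<le> 1"
    then have "segment_point t \<in> standard_simplex 1" by (simp add: segment_point_in_standard_simplex)
    then show "f (projected_simplex (linepath 0 u) (segment_point t)) = (exp \<circ> (\<lambda>t. 2 * of_real pi * \<i> * of_real (t * r u))) t"
      by (simp add: projected_simplex_def assms segment_point_def linepath_def linear_scale[OF assms(2)])
  qed
  also have "\<dots> = of_real (r u)"
    by (subst winding_number_compose_exp)
      (auto simp: path_def pathfinish_def pathstart_def intro!: continuous_intros)
  finally show ?thesis .
qed

text \<open>The cocycles of the two circle coordinates are homology invariants, and they read off
  the two entries of \<open>k\<close>.\<close>

lemma torus_chain_homologous_imp_eq:
  assumes "homologous_rel 1 torus {} (torus_chain k) (torus_chain l)"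
  shows "k = l"
proof -
  have nz: "fst z \<noteq> 0" "snd z \<noteq> 0" if "z \<in> topspace torus" for z
    using that by (auto simp: torus_def)
  have "continuous_map torus euclidean fst" "continuous_map torus euclidean snd"
    by (auto simp: torus_def intro!: continuous_intros)
  note inv = chain_eval_homologous[OF this(1) nz(1) assms] chain_eval_homologous[OF this(2) nz(2) assms]
  have "fst (torus_proj z) = exp (2 * of_real pi * \<i> * of_real (fst z))"
    "snd (torus_proj z) = exp (2 * of_real pi * \<i> * of_real (snd z))" for z
    by (simp_all add: torus_proj_def cis_conv_exp mult_ac)
  note rad = coordinate_winding_radial[OF this(1) linear_fst] coordinate_winding_radial[OF this(2) linear_snd]
  show ?thesis
    using inv by (simp add: torus_chain_def chain_eval_add chain_eval_cmul rad prod_eq_iff)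
qed

text \<open>The definite description has a witness by hypothesis; it is unique because the
  generators are independent.\<close>

lemma homology_type_eqI:
  assumes "homologous_rel 1 torus {} (transition_cycle E W B \<omega>0 \<omega>) (torus_chain k)"
  shows "homology_type E W B \<omega>0 \<omega> = k"
  unfolding homology_type_def
proof (rule the_equality)
  have c: "homology_class (transition_cycle E W B \<omega>0 \<omega>) = homology_class (torus_chain k)"
    using assms by (simp add: homologous_rel_set_eq)
  then show "case k of (m, n) \<Rightarrow> homology_class (transition_cycle E W B \<omega>0 \<omega>) =
        torus_gen1 [^]\<^bsub>H1_torus\<^esub> m \<otimes>\<^bsub>H1_torus\<^esub> torus_gen2 [^]\<^bsub>H1_torus\<^esub> n"
    by (cases k) (simp add: homology_class_torus_chain)
  fix l :: "int \<times> int"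
  assume "case l of (m, n) \<Rightarrow> homology_class (transition_cycle E W B \<omega>0 \<omega>) =
        torus_gen1 [^]\<^bsub>H1_torus\<^esub> m \<otimes>\<^bsub>H1_torus\<^esub> torus_gen2 [^]\<^bsub>H1_torus\<^esub> n"
  then have "homology_class (torus_chain l) = homology_class (torus_chain k)"
    using c by (cases l) (simp add: homology_class_torus_chain)
  then show "l = k"
    by (simp add: homologous_rel_set_eq torus_chain_homologous_imp_eq)
qed

lemma homologous_rel_finite_sum:
  assumes "finite I" "\<And>i. i \<in> I \<Longrightarrow> homologous_rel p X S (f i) (g i)"
  shows "homologous_rel p X S (sum f I) (sum g I)"
  using assms by (intro homologous_rel_sum) auto

section \<open>The torus graph and its lifts\<close>

lemma Ints2_add: "a \<in> \<int> \<times> \<int> \<Longrightarrow> b \<in> \<int> \<times> \<int> \<Longrightarrow> a + b \<in> \<int> \<times> \<int>" for a b :: plane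
  by (auto simp: mem_Times_iff)

lemma Ints2_diff: "a \<in> \<int> \<times> \<int> \<Longrightarrow> b \<in> \<int> \<times> \<int> \<Longrightarrow> a - b \<in> \<int> \<times> \<int>" for a b :: plane
  by (auto simp: mem_Times_iff)

lemma Ints2_scaleR: "r \<in> \<int> \<Longrightarrow> a \<in> \<int> \<times> \<int> \<Longrightarrow> r *\<^sub>R a \<in> \<int> \<times> \<int>" for a :: plane
  by (auto simp: mem_Times_iff)

lemma Ints2_zero: "(0 :: plane) \<in> \<int> \<times> \<int>"
  by (auto simp: mem_Times_iff)

lemma Ints2_sum: "(\<And>i. i \<in> I \<Longrightarrow> f i \<in> \<int> \<times> \<int>) \<Longrightarrow> sum f I \<in> \<int> \<times> \<int>" for f :: "'i \<Rightarrow> plane"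
  by (induction I rule: infinite_finite_induct) (simp_all add: Ints2_zero Ints2_add del: mem_Sigma_iff)

lemma Ints2_eq_lattice_point: "a \<in> \<int> \<times> \<int> \<Longrightarrow> \<exists>k. a = lattice_point k"
  by (auto simp: lattice_point_def elim!: Ints_cases)

text \<open>Invariance of domain. It is applied to the faces, in order to deduce that the graph is
  closed.\<close>

lemma open_if_homeomorphic_ball:
  fixes C :: "plane set"
  assumes "C homeomorphic ball (0 :: plane) 1"
  shows "open C"
proof -
  have "ball (0 :: plane) 1 homeomorphic C" using assms by (subst homeomorphic_sym)
  then obtain f g where "homeomorphism (ball (0 :: plane) 1) C f g"
    unfolding homeomorphic_def by blast
  then have f: "continuous_on (ball 0 1) f" "f ` ball 0 1 = C" "\<And>x. x \<in> ball 0 1 \<Longrightarrow> g (f x) = x"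
    by (simp_all add: homeomorphism_def)
  moreover have "inj_on f (ball 0 1)" by (rule inj_on_inverseI[of _ g]) (rule f(3))
  ultimately show ?thesis using invariance_of_domain[of "ball 0 1" f] by simp
qed

text \<open>Such a set is compact, and a limit point \<open>z\<close> of it would contradict the
  closedness of \<open>S - {z}\<close>.\<close>

lemma finite_if_all_subsets_closed:
  fixes S :: "'a::heine_borel set"
  assumes "bounded S" "\<And>T. T \<subseteq> S \<Longrightarrow> closed T"
  shows "finite S"
proof -
  have "compact S" using assms by (simp add: compact_eq_bounded_closed)
  moreover have "\<not> z islimpt S" for z
  proof
    assume "z islimpt S"
    then have "z islimpt (S - {z})" unfolding islimpt_def by blast
    moreover have "closed (S - {z})" using assms(2) by simp
    ultimately show False using closed_limpt by blast
  qed
  ultimately show ?thesis using finite_not_islimpt_in_compact[of S S] by simp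
qed

text \<open>Splits each plane point into a lattice part and a part depending only on its projection;
  sums over vertices of the torus then separate in the same way.\<close>

lemma torus_representatives:
  "\<exists>(rep :: torus_point \<Rightarrow> plane) (k :: plane \<Rightarrow> int \<times> int). \<forall>u. u = lattice_point (k u) + rep (torus_proj u)"
proof -
  define rep where "rep v = (SOME u. torus_proj u = v)" for v
  have "\<exists>k. u = lattice_point k + rep (torus_proj u)" for u
  proof -
    have "torus_proj (rep (torus_proj u)) = torus_proj u"
      unfolding rep_def by (rule someI[of "\<lambda>w. torus_proj w = torus_proj u"]) (rule refl)
    then have "u - rep (torus_proj u) \<in> \<int> \<times> \<int>" by (metis torus_proj_eq_iff)
    from Ints2_eq_lattice_point[OF this]
    obtain k where "u - rep (torus_proj u) = lattice_point k" ..
    then have "u = lattice_point k + rep (torus_proj u)" by (simp only: diff_eq_eq)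
    then show ?thesis by (rule exI)
  qed
  then have "\<forall>u. \<exists>k. u = lattice_point k + rep (torus_proj u)" by (rule allI)
  from choice[OF this] show ?thesis by (rule exI[of _ rep])
qed

section \<open>The periodic graph and its finite quotient\<close>

locale bipartite_periodic =
  fixes V W B :: "plane set" and E :: "plane set set"
  assumes graph: "bipartite_periodic_graph V E W B"
begin

lemma embedded: "embedded_graph V E"
  using graph unfolding bipartite_periodic_graph_def periodic_graph_def cellular_graph_def
  by (elim conjE)

lemma V_eq: "V = W \<union> B" and colours_disjoint: "W \<inter> B = {}"
  by (rule graph[unfolded bipartite_periodic_graph_def, THEN conjunct2, THEN conjunct1])
    (rule graph[unfolded bipartite_periodic_graph_def, THEN conjunct2, THEN conjunct2, THEN conjunct1])

lemma white_in_V: "u \<in> W \<Longrightarrow> u \<in> V" and black_in_V: "u \<in> B \<Longrightarrow> u \<in> V"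
  by (simp_all add: V_eq)

lemma white_not_black: "u \<in> W \<Longrightarrow> u \<notin> B"
  by (rule notI) (use colours_disjoint IntI[of u W B] in simp)

lemma translate_sets:
  assumes "a \<in> \<int> \<times> \<int>"
  shows "(+) a ` W = W" "(+) a ` B = B" "(\<lambda>e. (+) a ` e) ` E = E"
proof -
  have col: "\<forall>a\<in>\<int> \<times> \<int>. (+) a ` W = W \<and> (+) a ` B = B"
    using graph unfolding bipartite_periodic_graph_def by (elim conjE)
  have edg: "\<forall>a\<in>\<int> \<times> \<int>. (+) a ` V = V \<and> (\<lambda>e. (+) a ` e) ` E = E"
    using graph unfolding bipartite_periodic_graph_def periodic_graph_def by (elim conjE)
  show "(+) a ` W = W" "(+) a ` B = B" "(\<lambda>e. (+) a ` e) ` E = E"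
    by (fact col[THEN bspec, OF assms, THEN conjunct1] col[THEN bspec, OF assms, THEN conjunct2]
        edg[THEN bspec, OF assms, THEN conjunct2])+
qed

lemma translate_W: "a \<in> \<int> \<times> \<int> \<Longrightarrow> a + u \<in> W \<longleftrightarrow> u \<in> W"
  and translate_B: "a \<in> \<int> \<times> \<int> \<Longrightarrow> a + u \<in> B \<longleftrightarrow> u \<in> B"
proof -
  have "a + u \<in> S \<longleftrightarrow> u \<in> S" if "(+) a ` S = S" for S
    using that inj_image_mem_iff[of "(+) a" u S] by simp
  note * = this
  assume a: "a \<in> \<int> \<times> \<int>"
  show "a + u \<in> W \<longleftrightarrow> u \<in> W" by (rule *[OF translate_sets(1)[OF a]])
  show "a + u \<in> B \<longleftrightarrow> u \<in> B" by (rule *[OF translate_sets(2)[OF a]])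
qed

lemma translate_V: "a \<in> \<int> \<times> \<int> \<Longrightarrow> a + u \<in> V \<longleftrightarrow> u \<in> V"
  unfolding V_eq by (simp add: translate_W translate_B del: mem_Sigma_iff)

lemma translate_E: "a \<in> \<int> \<times> \<int> \<Longrightarrow> e \<in> E \<Longrightarrow> (+) a ` e \<in> E"
  using translate_sets(3) by blast

lemma edge_ends: "e \<in> E \<Longrightarrow> \<exists>w\<in>W. \<exists>b\<in>B. e \<inter> V = {w, b}"
proof -
  have "\<forall>e\<in>E. \<exists>w\<in>W. \<exists>b\<in>B. e \<inter> V = {w, b}"
    using graph unfolding bipartite_periodic_graph_def by (elim conjE)
  then show "e \<in> E \<Longrightarrow> \<exists>w\<in>W. \<exists>b\<in>B. e \<inter> V = {w, b}" by (rule bspec)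
qed

text \<open>The two ends have different colours, so an edge is never a loop; its parametrisation is
  reversed if it starts at the black end.\<close>

lemma edge_arc:
  assumes "e \<in> E"
  obtains g where "arc g" "path_image g = e" "pathstart g \<in> W" "pathfinish g \<in> B"
    "e \<inter> V = {pathstart g, pathfinish g}"
proof -
  obtain g where g: "simple_path g" "path_image g = e" "e \<inter> V = {pathstart g, pathfinish g}"
    using embedded assms by (auto simp: embedded_graph_def)
  obtain w b where wb: "w \<in> W" "b \<in> B" "e \<inter> V = {w, b}"
    using edge_ends[OF assms] by blast
  have "w \<noteq> b" using wb colours_disjoint by blast
  with g(3) wb(3) have "pathstart g \<noteq> pathfinish g" by auto
  then have arc: "arc g" using g(1) by (simp add: arc_simple_path)
  consider "pathstart g = w" "pathfinish g = b" | "pathstart g = b" "pathfinish g = w"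
    using g(3) wb(3) by (auto simp: doubleton_eq_iff)
  then show ?thesis
  proof cases
    case 1
    then show ?thesis using that[of g] arc g wb by simp
  next
    case 2
    then show ?thesis
      using that[of "reversepath g"] arc g wb by (simp add: arc_reversepath insert_commute)
  qed
qed

lemma edges_meet_in_V: "e \<in> E \<Longrightarrow> e' \<in> E \<Longrightarrow> z \<in> e \<Longrightarrow> z \<in> e' \<Longrightarrow> z \<notin> V \<Longrightarrow> e = e'"
  using embedded unfolding embedded_graph_def by blast

lemma edge_interior_point:
  assumes "e \<in> E"
  obtains z where "z \<in> e" "z \<notin> V"
proof -
  obtain g where g: "arc g" "path_image g = e" "e \<inter> V = {pathstart g, pathfinish g}"
    by (rule edge_arc[OF assms])
  have inj: "inj_on g {0..1}" using g(1) by (simp add: arc_def)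
  have "g (1/2) \<in> e" using g(2) by (auto simp: path_image_def)
  moreover have "g (1/2) \<noteq> g 0" "g (1/2) \<noteq> g 1"
    using inj_onD[OF inj, of "1/2" 0] inj_onD[OF inj, of "1/2" 1] by auto
  ultimately show ?thesis
    using g(3) by (intro that[of "g (1/2)"]) (auto simp: pathstart_def pathfinish_def)
qed

abbreviation "lift \<equiv> edge_lift E W B"
abbreviation "Eh \<equiv> torus_edges E"
abbreviation "Vh \<equiv> torus_vertices V"

definition src :: "torus_point set \<Rightarrow> plane" where "src e = pathstart (lift e)"
definition tgt :: "torus_point set \<Rightarrow> plane" where "tgt e = pathfinish (lift e)"
definition disp :: "torus_point set \<Rightarrow> plane" where "disp e = tgt e - src e"

lemma lift_props:
  assumes "e \<in> Eh"
  shows "arc (lift e)" "path_image (lift e) \<in> E" "torus_proj ` path_image (lift e) = e"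
    "src e \<in> W" "tgt e \<in> B"
proof -
  obtain e' where e': "e' \<in> E" "e = torus_proj ` e'" using assms by (auto simp: torus_edges_def)
  obtain g where g: "arc g" "path_image g = e'" "pathstart g \<in> W" "pathfinish g \<in> B"
    by (rule edge_arc[OF e'(1)])
  have "\<exists>g. arc g \<and> path_image g \<in> E \<and> torus_proj ` path_image g = e \<and> pathstart g \<in> W \<and> pathfinish g \<in> B"
    using e' g by (intro exI[of _ g]) simp
  from someI_ex[OF this, folded edge_lift_def]
  show "arc (lift e)" "path_image (lift e) \<in> E" "torus_proj ` path_image (lift e) = e"
    "src e \<in> W" "tgt e \<in> B"
    by (auto simp: src_def tgt_def)
qed

lemma src_tgt_in_V: "e \<in> Eh \<Longrightarrow> src e \<in> V" "e \<in> Eh \<Longrightarrow> tgt e \<in> V"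
  by (simp_all add: white_in_V black_in_V lift_props)

lemma lift_vertices:
  assumes "e \<in> Eh"
  shows "path_image (lift e) \<inter> V = {src e, tgt e}"
proof -
  obtain w b where "w \<in> W" "b \<in> B" "path_image (lift e) \<inter> V = {w, b}"
    using edge_ends[OF lift_props(2)[OF assms]] by blast
  moreover have "src e \<in> path_image (lift e) \<inter> V" "tgt e \<in> path_image (lift e) \<inter> V"
    using src_tgt_in_V[OF assms] by (auto simp: src_def tgt_def)
  moreover have "src e \<noteq> tgt e" using lift_props(4,5)[OF assms] white_not_black by metis
  ultimately show ?thesis by (simp; elim disjE; simp add: insert_commute)
qed

lemma translated_lift_vertices:
  assumes "e \<in> Eh" "a \<in> \<int> \<times> \<int>" "z \<in> (+) a ` path_image (lift e)" "z \<in> V"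
  shows "z = a + src e \<or> z = a + tgt e"
proof -
  obtain y where y: "z = a + y" "y \<in> path_image (lift e)" using assms(3) by auto
  then have "y \<in> V" using assms(4) translate_V[OF assms(2)] by simp
  then have "y \<in> {src e, tgt e}" using y(2) lift_vertices[OF assms(1)] by (metis IntI)
  then show ?thesis using y(1) by simp
qed

text \<open>Translations preserve the colours, so the colouring descends to the torus.\<close>

lemma torus_proj_colours:
  assumes "u \<in> W" "v \<in> B"
  shows "torus_proj u \<noteq> torus_proj v"
proof
  assume "torus_proj u = torus_proj v"
  then have a: "u - v \<in> \<int> \<times> \<int>" by (simp only: torus_proj_eq_iff)
  have "(u - v) + v \<in> B" using assms(2) by (simp only: translate_B[OF a])
  then show False using white_not_black[OF assms(1)] by simp
qed

text \<open>A point of the lift over a torus vertex differs from a plane vertex by a lattice vector,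
  so it is itself a vertex, hence an end of the lift.\<close>

lemma incident_iff:
  assumes "v \<in> Vh" "e \<in> Eh"
  shows "v \<in> e \<longleftrightarrow> v = torus_proj (src e) \<or> v = torus_proj (tgt e)"
proof
  assume "v \<in> e"
  then have "v \<in> torus_proj ` path_image (lift e)" by (simp add: lift_props(3)[OF assms(2)])
  then obtain y where y: "y \<in> path_image (lift e)" "v = torus_proj y" by blast
  obtain u where u: "u \<in> V" "v = torus_proj u" using assms(1) by (auto simp: torus_vertices_def)
  have "y - u \<in> \<int> \<times> \<int>" using y u by (metis torus_proj_eq_iff)
  then have "y \<in> V" using translate_V[of "y - u" u] u by simp
  then have "y \<in> {src e, tgt e}" using y(1) lift_vertices[OF assms(2)] by (metis IntI)
  then show "v = torus_proj (src e) \<or> v = torus_proj (tgt e)" using y by blast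
next
  have "src e \<in> path_image (lift e)" "tgt e \<in> path_image (lift e)" by (auto simp: src_def tgt_def)
  moreover assume "v = torus_proj (src e) \<or> v = torus_proj (tgt e)"
  ultimately have "v \<in> torus_proj ` path_image (lift e)" by blast
  then show "v \<in> e" by (simp add: lift_props(3)[OF assms(2)])
qed

lemma incident_white_iff:
  assumes "u \<in> W" "e \<in> Eh"
  shows "torus_proj u \<in> e \<longleftrightarrow> torus_proj u = torus_proj (src e)"
  using incident_iff[of "torus_proj u" e] torus_proj_colours[OF assms(1) lift_props(5)] assms white_in_V
  by (auto simp: torus_vertices_def)

lemma incident_black_iff:
  assumes "u \<in> B" "e \<in> Eh"
  shows "torus_proj u \<in> e \<longleftrightarrow> torus_proj u = torus_proj (tgt e)"
  using incident_iff[of "torus_proj u" e] torus_proj_colours[OF lift_props(4) assms(1), of e] assms black_in_V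
  by (auto simp: torus_vertices_def)

lemma closed_graph: "closed (V \<union> \<Union>E)"
proof -
  have "open C" if "C \<in> components (- (V \<union> \<Union>E))" for C
  proof -
    have "\<forall>C\<in>components (- (V \<union> \<Union>E)). C homeomorphic ball (0 :: plane) 1"
      using graph unfolding bipartite_periodic_graph_def periodic_graph_def cellular_graph_def
      by (elim conjE)
    then show ?thesis using that open_if_homeomorphic_ball by blast
  qed
  then have "open (\<Union>(components (- (V \<union> \<Union>E))))" by blast
  then show ?thesis by (simp only: Union_components closed_def)
qed

text \<open>From each torus edge a point off the vertices is chosen, lifted to the unit square.
  Distinct edges give distinct points, and every set of these points is closed, so there are
  finitely many.\<close>

lemma finite_torus_edges: "finite Eh"
proof -
  have "\<exists>z. z \<in> cbox (0, 0) (1, 1) \<and> z \<notin> V \<and> (\<exists>e'\<in>E. z \<in> e' \<and> torus_proj ` e' = e)" if "e \<in> Eh" for e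
  proof -
    obtain e' where e': "e' \<in> E" "e = torus_proj ` e'" using \<open>e \<in> Eh\<close> by (auto simp: torus_edges_def)
    obtain z where z: "z \<in> e'" "z \<notin> V" by (rule edge_interior_point[OF e'(1)])
    define a :: plane where "a = - (of_int \<lfloor>fst z\<rfloor>, of_int \<lfloor>snd z\<rfloor>)"
    have a: "a \<in> \<int> \<times> \<int>" by (simp add: a_def)
    have "a + z \<in> cbox (0, 0) (1, 1)"
      by (cases z) (simp add: a_def cbox_Pair_eq, linarith)
    moreover have "a + z \<notin> V" using translate_V[OF a] z(2) by simp
    moreover have "torus_proj ` (+) a ` e' = e"
      unfolding image_image e'(2) by (simp add: torus_proj_add_Ints[OF a])
    ultimately show ?thesis using translate_E[OF a e'(1)] z(1) by blast
  qed
  then obtain z where z: "\<And>e. e \<in> Eh \<Longrightarrow> z e \<in> cbox (0, 0) (1, 1)" "\<And>e. e \<in> Eh \<Longrightarrow> z e \<notin> V"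
    "\<And>e. e \<in> Eh \<Longrightarrow> \<exists>e'\<in>E. z e \<in> e' \<and> torus_proj ` e' = e"
    by metis
  have zuniq: "torus_proj ` e' = e" if "e \<in> Eh" "e' \<in> E" "z e \<in> e'" for e e'
    using z(2,3)[OF that(1)] edges_meet_in_V that by metis
  have "finite (z ` Eh)"
  proof (rule finite_if_all_subsets_closed)
    show "bounded (z ` Eh)" using z(1) by (intro bounded_subset[OF bounded_cbox]) auto
    fix T assume T: "T \<subseteq> z ` Eh"
    have sub: "T \<subseteq> V \<union> \<Union>E" using T z(3) by blast
    \<comment> \<open>By \<open>zuniq\<close>, \<open>e'\<close> contains at most the point chosen
      for its own projection.\<close>
    have "closedin (top_of_set e') (T \<inter> e')" if "e' \<in> E" for e'
    proof -
      have "T \<inter> e' \<subseteq> {z (torus_proj ` e')}" using T zuniq that by blast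
      then have "finite (T \<inter> e')" using finite_subset by blast
      then have "closed (T \<inter> e')" by (rule finite_imp_closed)
      then show ?thesis by (simp add: closed_subset)
    qed
    \<comment> \<open>Here the embedding being a homeomorphism onto its image enters: closedness may
      be tested edge by edge.\<close>
    then have "closedin (top_of_set (V \<union> \<Union>E)) T"
      using embedded sub unfolding embedded_graph_def by blast
    then show "closed T" using closed_graph closedin_closed_trans by blast
  qed
  moreover have "inj_on z Eh"
    by (intro inj_onI) (metis z(3) zuniq)
  ultimately show ?thesis using finite_imageD by blast
qed

section \<open>Perfect matchings and their homology types\<close>

lemma bij_betw_matching:
  assumes M: "M \<in> perfect_matchings Vh Eh"
  shows "bij_betw (\<lambda>e. torus_proj (src e)) M (torus_proj ` W)"
    "bij_betw (\<lambda>e. torus_proj (tgt e)) M (torus_proj ` B)"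
proof -
  have sub: "M \<subseteq> Eh" and ex1: "\<And>v. v \<in> Vh \<Longrightarrow> \<exists>!e. e \<in> M \<and> v \<in> e"
    using M by (auto simp: perfect_matchings_def)
  have W1: "\<exists>!e. e \<in> M \<and> torus_proj u = torus_proj (src e)" if "u \<in> W" for u
  proof -
    have "torus_proj u \<in> Vh" using white_in_V[OF that] by (simp add: torus_vertices_def)
    then have "\<exists>!e. e \<in> M \<and> torus_proj u \<in> e" by (rule ex1)
    moreover have "e \<in> M \<and> torus_proj u \<in> e \<longleftrightarrow> e \<in> M \<and> torus_proj u = torus_proj (src e)" for e
      using incident_white_iff[OF that, of e] sub by blast
    ultimately show ?thesis by (simp only:)
  qed
  have B1: "\<exists>!e. e \<in> M \<and> torus_proj u = torus_proj (tgt e)" if "u \<in> B" for u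
  proof -
    have "torus_proj u \<in> Vh" using black_in_V[OF that] by (simp add: torus_vertices_def)
    then have "\<exists>!e. e \<in> M \<and> torus_proj u \<in> e" by (rule ex1)
    moreover have "e \<in> M \<and> torus_proj u \<in> e \<longleftrightarrow> e \<in> M \<and> torus_proj u = torus_proj (tgt e)" for e
      using incident_black_iff[OF that, of e] sub by blast
    ultimately show ?thesis by (simp only:)
  qed
  show "bij_betw (\<lambda>e. torus_proj (src e)) M (torus_proj ` W)"
    unfolding bij_betw_def
  proof
    show "inj_on (\<lambda>e. torus_proj (src e)) M"
    proof (rule inj_onI)
      fix e e' assume e: "e \<in> M" "e' \<in> M" "torus_proj (src e) = torus_proj (src e')"
      then have "src e \<in> W" using lift_props(4) sub by blast
      then show "e = e'" using W1[of "src e"] e by metis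
    qed
    show "(\<lambda>e. torus_proj (src e)) ` M = torus_proj ` W"
    proof (intro subset_antisym image_subsetI)
      fix e assume "e \<in> M"
      then show "torus_proj (src e) \<in> torus_proj ` W" using lift_props(4) sub by blast
    next
      fix u assume "u \<in> W"
      then show "torus_proj u \<in> (\<lambda>e. torus_proj (src e)) ` M" using W1[of u] by blast
    qed
  qed
  show "bij_betw (\<lambda>e. torus_proj (tgt e)) M (torus_proj ` B)"
    unfolding bij_betw_def
  proof
    show "inj_on (\<lambda>e. torus_proj (tgt e)) M"
    proof (rule inj_onI)
      fix e e' assume e: "e \<in> M" "e' \<in> M" "torus_proj (tgt e) = torus_proj (tgt e')"
      then have "tgt e \<in> B" using lift_props(5) sub by blast
      then show "e = e'" using B1[of "tgt e"] e by metis
    qed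
    show "(\<lambda>e. torus_proj (tgt e)) ` M = torus_proj ` B"
    proof (intro subset_antisym image_subsetI)
      fix e assume "e \<in> M"
      then show "torus_proj (tgt e) \<in> torus_proj ` B" using lift_props(5) sub by blast
    next
      fix u assume "u \<in> B"
      then show "torus_proj u \<in> (\<lambda>e. torus_proj (tgt e)) ` M" using B1[of u] by blast
    qed
  qed
qed

text \<open>The right-hand sides do not involve \<open>M\<close>: contributions that depend only on
  projected end points are the same for all matchings and cancel in differences.\<close>

lemma sum_matching:
  assumes "M \<in> perfect_matchings Vh Eh"
  shows "(\<Sum>e\<in>M. f (torus_proj (src e))) = (\<Sum>v\<in>torus_proj ` W. f v)"
    "(\<Sum>e\<in>M. f (torus_proj (tgt e))) = (\<Sum>v\<in>torus_proj ` B. f v)"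
  using sum.reindex_bij_betw[OF bij_betw_matching(1)[OF assms], of f]
    sum.reindex_bij_betw[OF bij_betw_matching(2)[OF assms], of f] by auto

text \<open>Replaces homology by plane displacements. After each end is split into lattice part and
  representative, the chain and the displacement of a matching are given by the same lattice vector,
  up to constants common to all matchings.\<close>

lemma lattice_point_homology_type:
  assumes M: "M \<in> perfect_matchings Vh Eh" and M0: "M0 \<in> perfect_matchings Vh Eh"
  shows "lattice_point (homology_type E W B M0 M) = (\<Sum>e\<in>M. disp e) - (\<Sum>e\<in>M0. disp e)"
proof -
  from torus_representatives obtain rep :: "torus_point \<Rightarrow> plane" and k :: "plane \<Rightarrow> int \<times> int"
    where "\<forall>u. u = lattice_point (k u) + rep (torus_proj u)" by (elim exE)
  note rep = this[rule_format]
  define d where "d e = k (tgt e) - k (src e)" for e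
  let ?P = "\<lambda>e. frag_of (projected_simplex (lift e))"
  \<comment> \<open>The total contribution of the representatives, to the chain and to the
    displacement; by \<open>sum_matching\<close> it is independent of the matching.\<close>
  define cst where "cst = (\<Sum>v\<in>torus_proj ` B. radial_chain (rep v)) - (\<Sum>v\<in>torus_proj ` W. radial_chain (rep v))"
  define cst' where "cst' = (\<Sum>v\<in>torus_proj ` B. rep v) - (\<Sum>v\<in>torus_proj ` W. rep v)"
  have radial: "homologous_rel 1 torus {} (radial_chain u) (torus_chain (k u) + radial_chain (rep (torus_proj u)))" for u
  proof -
    have "homologous_rel 1 torus {} (radial_chain (lattice_point (k u) + rep (torus_proj u)))
        (radial_chain (lattice_point (k u)) + radial_chain (rep (torus_proj u)))"
      by (rule radial_chain_add[OF lattice_point_in_Ints])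
    moreover have "homologous_rel 1 torus {} (radial_chain (lattice_point (k u)) + radial_chain (rep (torus_proj u)))
        (torus_chain (k u) + radial_chain (rep (torus_proj u)))"
      by (rule homologous_rel_add[OF radial_chain_lattice_point homologous_rel_refl])
    ultimately show ?thesis unfolding rep[of u, symmetric] by (rule homologous_rel_trans[rotated])
  qed
  have chain: "homologous_rel 1 torus {} (\<Sum>e\<in>N. ?P e) (torus_chain (\<Sum>e\<in>N. d e) + cst)"
    and vec: "(\<Sum>e\<in>N. disp e) = lattice_point (\<Sum>e\<in>N. d e) + cst'"
    if N: "N \<in> perfect_matchings Vh Eh" for N
  proof -
    have sub: "N \<subseteq> Eh" using N by (simp add: perfect_matchings_def)
    then have fin: "finite N" using finite_torus_edges finite_subset by blast
    have "homologous_rel 1 torus {} (?P e)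
        ((torus_chain (k (tgt e)) + radial_chain (rep (torus_proj (tgt e)))) -
         (torus_chain (k (src e)) + radial_chain (rep (torus_proj (src e)))))" if "e \<in> N" for e
    proof -
      have "path (lift e)" using lift_props(1) sub that arc_imp_path by blast
      from homologous_projected_simplex[OF this]
      have "homologous_rel 1 torus {} (?P e) (radial_chain (tgt e) - radial_chain (src e))"
        by (simp only: src_def tgt_def)
      then show ?thesis
        by (rule homologous_rel_trans[rotated]) (intro homologous_rel_diff radial)
    qed
    from homologous_rel_finite_sum[OF fin this]
    have "homologous_rel 1 torus {} (\<Sum>e\<in>N. ?P e)
        (\<Sum>e\<in>N. (torus_chain (k (tgt e)) + radial_chain (rep (torus_proj (tgt e)))) -
         (torus_chain (k (src e)) + radial_chain (rep (torus_proj (src e)))))" .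
    moreover have "(\<Sum>e\<in>N. (torus_chain (k (tgt e)) + radial_chain (rep (torus_proj (tgt e)))) -
         (torus_chain (k (src e)) + radial_chain (rep (torus_proj (src e))))) = torus_chain (\<Sum>e\<in>N. d e) + cst"
      unfolding torus_chain_sum d_def torus_chain_diff cst_def
        sum_matching(1)[OF N, of "\<lambda>v. radial_chain (rep v)", symmetric]
        sum_matching(2)[OF N, of "\<lambda>v. radial_chain (rep v)", symmetric]
      by (simp add: sum_subtractf sum.distrib)
    ultimately show "homologous_rel 1 torus {} (\<Sum>e\<in>N. ?P e) (torus_chain (\<Sum>e\<in>N. d e) + cst)" by simp
    have "disp e = (lattice_point (k (tgt e)) + rep (torus_proj (tgt e))) -
         (lattice_point (k (src e)) + rep (torus_proj (src e)))" for e
      unfolding disp_def rep[symmetric] ..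
    then show "(\<Sum>e\<in>N. disp e) = lattice_point (\<Sum>e\<in>N. d e) + cst'"
      unfolding lattice_point_sum d_def lattice_point_diff cst'_def
        sum_matching(1)[OF N, of rep, symmetric] sum_matching(2)[OF N, of rep, symmetric]
      by (simp add: sum_subtractf sum.distrib)
  qed
  have fin: "finite M" "finite M0"
    using M M0 finite_torus_edges finite_subset unfolding perfect_matchings_def by blast+
  \<comment> \<open>Edges common to both matchings cancel, so the full sums may be compared.\<close>
  have "transition_cycle E W B M0 M = (\<Sum>e\<in>M. ?P e) - (\<Sum>e\<in>M0. ?P e)"
  proof -
    have "(\<Sum>e\<in>M. ?P e) = (\<Sum>e\<in>M - M0. ?P e) + (\<Sum>e\<in>M \<inter> M0. ?P e)"
      using sum.Int_Diff[OF fin(1), of ?P M0] by (simp add: add.commute)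
    moreover have "(\<Sum>e\<in>M0. ?P e) = (\<Sum>e\<in>M0 - M. ?P e) + (\<Sum>e\<in>M \<inter> M0. ?P e)"
      using sum.Int_Diff[OF fin(2), of ?P M] by (simp add: add.commute Int_commute)
    ultimately show ?thesis by (simp add: transition_cycle_def)
  qed
  moreover have "homologous_rel 1 torus {} ((\<Sum>e\<in>M. ?P e) - (\<Sum>e\<in>M0. ?P e))
      ((torus_chain (\<Sum>e\<in>M. d e) + cst) - (torus_chain (\<Sum>e\<in>M0. d e) + cst))"
    by (intro homologous_rel_diff chain M M0)
  ultimately have "homologous_rel 1 torus {} (transition_cycle E W B M0 M) (torus_chain ((\<Sum>e\<in>M. d e) - (\<Sum>e\<in>M0. d e)))"
    by (simp add: torus_chain_diff)
  then have "homology_type E W B M0 M = (\<Sum>e\<in>M. d e) - (\<Sum>e\<in>M0. d e)"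
    by (rule homology_type_eqI)
  then show ?thesis by (simp add: lattice_point_diff vec[OF M] vec[OF M0])
qed

subsection \<open>Lifted walks and their flows\<close>

text \<open>A walk in the plane along translates of lifts of edges in \<open>F\<close>, from
  \<open>u\<close> to the last argument. The function records its flow: the number of traversals of
  each torus edge, positive from white to black and negative backwards.\<close>

inductive walk :: "torus_point set set \<Rightarrow> plane \<Rightarrow> (torus_point set \<Rightarrow> int) \<Rightarrow> plane \<Rightarrow> bool"
  for F u where
  stay: "u \<in> V \<Longrightarrow> walk F u (\<lambda>_. 0) u"
| forward: "walk F u g (a + src e) \<Longrightarrow> e \<in> F \<Longrightarrow> a \<in> \<int> \<times> \<int> \<Longrightarrow>
    walk F u (\<lambda>e'. g e' + of_bool (e' = e)) (a + tgt e)"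
| backward: "walk F u g (a + tgt e) \<Longrightarrow> e \<in> F \<Longrightarrow> a \<in> \<int> \<times> \<int> \<Longrightarrow>
    walk F u (\<lambda>e'. g e' - of_bool (e' = e)) (a + src e)"

lemma walk_start_in_V: "walk F u g w \<Longrightarrow> u \<in> V"
  by (induction rule: walk.induct)

lemma walk_end_in_V: "walk F u g w \<Longrightarrow> F \<subseteq> Eh \<Longrightarrow> w \<in> V"
proof (induction rule: walk.induct)
  case (forward g a e)
  then have "tgt e \<in> V" using src_tgt_in_V by blast
  then show ?case using translate_V[OF \<open>a \<in> \<int> \<times> \<int>\<close>] by simp
next
  case (backward g a e)
  then have "src e \<in> V" using src_tgt_in_V by blast
  then show ?case using translate_V[OF \<open>a \<in> \<int> \<times> \<int>\<close>] by simp
qed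

lemma walk_support: "walk F u g w \<Longrightarrow> e \<notin> F \<Longrightarrow> g e = 0"
  by (induction rule: walk.induct) auto

lemma walk_mono: "walk F u g w \<Longrightarrow> F \<subseteq> F' \<Longrightarrow> walk F' u g w"
  by (induction rule: walk.induct) (auto intro: walk.intros)

lemma walk_trans:
  assumes "walk F u g v" "walk F v g' w"
  shows "walk F u (\<lambda>e. g e + g' e) w"
  using assms(2,1)
proof (induction rule: walk.induct)
  case (forward g' a e)
  from walk.forward[OF forward.IH[OF forward.prems] forward.hyps(2,3)]
  show ?case by (simp only: add.assoc)
next
  case (backward g' a e)
  from walk.backward[OF backward.IH[OF backward.prems] backward.hyps(2,3)]
  show ?case by (simp only: add_diff_eq)
qed simp

lemma walk_sym:
  assumes "walk F u g w" "F \<subseteq> Eh"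
  shows "walk F w (\<lambda>e. - g e) u"
  using assms
proof (induction rule: walk.induct)
  case stay
  then show ?case using walk.stay by simp
next
  case (forward g a e)
  then have "tgt e \<in> V" using src_tgt_in_V by blast
  then have "a + tgt e \<in> V" using translate_V[OF \<open>a \<in> \<int> \<times> \<int>\<close>] by simp
  from walk.backward[OF walk.stay[OF this] forward.hyps(2,3)]
  have "walk F (a + tgt e) (\<lambda>e'. 0 - of_bool (e' = e)) (a + src e)" .
  from walk_trans[OF this forward.IH[OF forward.prems]]
  show ?case by (simp add: add.commute)
next
  case (backward g a e)
  then have "src e \<in> V" using src_tgt_in_V by blast
  then have "a + src e \<in> V" using translate_V[OF \<open>a \<in> \<int> \<times> \<int>\<close>] by simp
  from walk.forward[OF walk.stay[OF this] backward.hyps(2,3)]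
  have "walk F (a + src e) (\<lambda>e'. 0 + of_bool (e' = e)) (a + tgt e)" .
  from walk_trans[OF this backward.IH[OF backward.prems]]
  show ?case by simp
qed

lemma walk_translate:
  assumes "walk F u g w" "b \<in> \<int> \<times> \<int>"
  shows "walk F (b + u) g (b + w)"
  using assms(1)
proof (induction rule: walk.induct)
  case stay
  then show ?case using walk.stay translate_V[OF assms(2)] by simp
next
  case (forward g a e)
  have "walk F (b + u) g ((b + a) + src e)" using forward.IH by (simp only: add.assoc)
  from walk.forward[OF this forward.hyps(2) Ints2_add[OF assms(2) forward.hyps(3)]]
  show ?case by (simp only: add.assoc)
next
  case (backward g a e)
  have "walk F (b + u) g ((b + a) + tgt e)" using backward.IH by (simp only: add.assoc)
  from walk.backward[OF this backward.hyps(2) Ints2_add[OF assms(2) backward.hyps(3)]]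
  show ?case by (simp only: add.assoc)
qed

section \<open>Flux and conservation of flow along walks\<close>

definition flux :: "(torus_point set \<Rightarrow> real) \<Rightarrow> plane" where
  "flux x = (\<Sum>e\<in>Eh. x e *\<^sub>R disp e)"

text \<open>The sum is unsigned. As all edges run from white to black, it is the divergence up to
  the sign of the colour; value 1 thus expresses a matching at \<open>v\<close>, and value 0
  conservation of a flow.\<close>

definition vertex_sum :: "(torus_point set \<Rightarrow> real) \<Rightarrow> torus_point \<Rightarrow> real" where
  "vertex_sum x v = (\<Sum>e\<in>{e \<in> Eh. v \<in> e}. x e)"

lemma flux_add: "flux (\<lambda>e. x e + y e) = flux x + flux y"
  by (simp add: flux_def scaleR_add_left sum.distrib)

lemma flux_diff: "flux (\<lambda>e. x e - y e) = flux x - flux y"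
  by (simp add: flux_def scaleR_diff_left sum_subtractf)

lemma flux_scale: "flux (\<lambda>e. r * x e) = r *\<^sub>R flux x"
  by (simp add: flux_def scaleR_sum_right)

lemma flux_unit: "e \<in> Eh \<Longrightarrow> flux (\<lambda>e'. of_bool (e' = e)) = disp e"
proof -
  assume e: "e \<in> Eh"
  have "flux (\<lambda>e'. of_bool (e' = e)) = (\<Sum>e'\<in>Eh. if e' = e then disp e' else 0)"
    unfolding flux_def by (intro sum.cong) auto
  then show ?thesis using e finite_torus_edges by simp
qed

lemma vertex_sum_add: "vertex_sum (\<lambda>e. x e + y e) v = vertex_sum x v + vertex_sum y v"
  by (simp add: vertex_sum_def sum.distrib)

lemma vertex_sum_diff: "vertex_sum (\<lambda>e. x e - y e) v = vertex_sum x v - vertex_sum y v"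
  by (simp add: vertex_sum_def sum_subtractf)

lemma vertex_sum_scale: "vertex_sum (\<lambda>e. r * x e) v = r * vertex_sum x v"
  by (simp add: vertex_sum_def sum_distrib_left)

lemma vertex_sum_unit: "e \<in> Eh \<Longrightarrow> vertex_sum (\<lambda>e'. of_bool (e' = e)) v = of_bool (v \<in> e)"
proof -
  assume e: "e \<in> Eh"
  have "vertex_sum (\<lambda>e'. of_bool (e' = e)) v = (\<Sum>e'\<in>{e \<in> Eh. v \<in> e}. if e' = e then 1 else 0)"
    unfolding vertex_sum_def by (intro sum.cong) auto
  then show ?thesis using e finite_torus_edges by simp
qed

text \<open>The displacements of the successive edges telescope.\<close>

lemma walk_flux:
  assumes "walk F u g w" "F \<subseteq> Eh"
  shows "flux (\<lambda>e. of_int (g e)) = w - u"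
  using assms
proof (induction rule: walk.induct)
  case stay
  then show ?case by (simp add: flux_def)
next
  case (forward g a e)
  then have e: "e \<in> Eh" by blast
  have "flux (\<lambda>e'. of_int (g e' + of_bool (e' = e))) = flux (\<lambda>e'. of_int (g e')) + flux (\<lambda>e'. of_bool (e' = e))"
    by (simp add: flux_add)
  then show ?case using forward.IH[OF forward.prems] flux_unit[OF e] by (simp add: disp_def)
next
  case (backward g a e)
  then have e: "e \<in> Eh" by blast
  have "flux (\<lambda>e'. of_int (g e' - of_bool (e' = e))) = flux (\<lambda>e'. of_int (g e')) - flux (\<lambda>e'. of_bool (e' = e))"
    by (simp add: flux_diff)
  then show ?case using backward.IH[OF backward.prems] flux_unit[OF e] by (simp add: disp_def)
qed

text \<open>The factor turning an unsigned vertex sum into the net inflow: black vertices are heads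
  of edges, white ones tails.\<close>

definition vertex_sign :: "torus_point \<Rightarrow> real" where
  "vertex_sign v = (if v \<in> torus_proj ` B then 1 else - 1)"

lemma vertex_sign_src: "e \<in> Eh \<Longrightarrow> vertex_sign (torus_proj (src e)) = - 1"
  using torus_proj_colours[OF lift_props(4)] by (auto simp: vertex_sign_def)

lemma vertex_sign_tgt: "e \<in> Eh \<Longrightarrow> vertex_sign (torus_proj (tgt e)) = 1"
  using lift_props(5) by (auto simp: vertex_sign_def)

lemma vertex_sign_incident:
  assumes "v \<in> Vh" "e \<in> Eh"
  shows "vertex_sign v * of_bool (v \<in> e) = of_bool (v = torus_proj (tgt e)) - of_bool (v = torus_proj (src e))"
proof -
  have "torus_proj (src e) \<noteq> torus_proj (tgt e)"
    by (rule torus_proj_colours[OF lift_props(4,5)[OF assms(2)]])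
  then show ?thesis
    using incident_iff[OF assms] vertex_sign_src[OF assms(2)] vertex_sign_tgt[OF assms(2)] by auto
qed

lemma walk_vertex_sum:
  assumes "walk F u g w" "F \<subseteq> Eh" "v \<in> Vh"
  shows "vertex_sign v * vertex_sum (\<lambda>e. of_int (g e)) v = of_bool (v = torus_proj w) - of_bool (v = torus_proj u)"
  using assms
proof (induction rule: walk.induct)
  case stay
  then show ?case by (simp add: vertex_sum_def)
next
  case (forward g a e)
  then have e: "e \<in> Eh" by blast
  have "vertex_sum (\<lambda>e'. of_int (g e' + of_bool (e' = e))) v
      = vertex_sum (\<lambda>e'. of_int (g e')) v + vertex_sum (\<lambda>e'. of_bool (e' = e)) v"
    by (simp add: vertex_sum_add)
  then show ?case
    using forward.IH[OF forward.prems] vertex_sum_unit[OF e, of v] vertex_sign_incident[OF assms(3) e]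
      torus_proj_add_Ints[OF forward.hyps(3)]
    by (simp add: distrib_left)
next
  case (backward g a e)
  then have e: "e \<in> Eh" by blast
  have "vertex_sum (\<lambda>e'. of_int (g e' - of_bool (e' = e))) v
      = vertex_sum (\<lambda>e'. of_int (g e')) v - vertex_sum (\<lambda>e'. of_bool (e' = e)) v"
    by (simp add: vertex_sum_diff)
  then show ?case
    using backward.IH[OF backward.prems] vertex_sum_unit[OF e, of v] vertex_sign_incident[OF assms(3) e]
      torus_proj_add_Ints[OF backward.hyps(3)]
    by (simp add: right_diff_distrib)
qed

text \<open>The ends of the walk have the same projection, so the net inflow is zero everywhere on
  the torus.\<close>

lemma closed_walk_vertex_sum:
  assumes "walk F u g (a + u)" "a \<in> \<int> \<times> \<int>" "F \<subseteq> Eh" "v \<in> Vh"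
  shows "vertex_sum (\<lambda>e. of_int (g e)) v = 0"
  using walk_vertex_sum[OF assms(1,3,4)] torus_proj_add_Ints[OF assms(2)]
  by (simp add: vertex_sign_def split: if_splits)

section \<open>Plane traces of walks, and planarity\<close>

text \<open>The point set traced by walks from \<open>u\<close>. Asking only for the white end of an
  edge to be reachable suffices, since a walk at the black end can cross the edge to the white
  one.\<close>

definition walk_component :: "torus_point set set \<Rightarrow> plane \<Rightarrow> plane set" where
  "walk_component F u = {z. \<exists>g w. walk F u g w \<and>
     (z = w \<or> (\<exists>e\<in>F. \<exists>a\<in>\<int> \<times> \<int>. w = a + src e \<and> z \<in> (+) a ` path_image (lift e)))}"

lemma walk_component_subset:
  assumes "walk F u g w"
  shows "walk_component F w \<subseteq> walk_component F u"
proof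
  fix z assume "z \<in> walk_component F w"
  then obtain g' w' where w': "walk F w g' w'"
    and z: "z = w' \<or> (\<exists>e\<in>F. \<exists>a\<in>\<int> \<times> \<int>. w' = a + src e \<and> z \<in> (+) a ` path_image (lift e))"
    unfolding walk_component_def by (elim CollectE exE conjE)
  from walk_trans[OF assms w'] z show "z \<in> walk_component F u"
    unfolding walk_component_def by (intro CollectI exI conjI)
qed

lemma walk_component_translate:
  assumes "z \<in> walk_component F u" and b: "b \<in> \<int> \<times> \<int>"
  shows "b + z \<in> walk_component F (b + u)"
proof -
  from assms obtain g w where w: "walk F u g w"
    and z: "z = w \<or> (\<exists>e\<in>F. \<exists>a\<in>\<int> \<times> \<int>. w = a + src e \<and> z \<in> (+) a ` path_image (lift e))"
    unfolding walk_component_def by (elim CollectE exE conjE)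
  from z have "b + z = b + w \<or> (\<exists>e\<in>F. \<exists>a\<in>\<int> \<times> \<int>. b + w = a + src e \<and> b + z \<in> (+) a ` path_image (lift e))"
  proof (elim disjE bexE conjE)
    fix e a assume e: "e \<in> F" "a \<in> \<int> \<times> \<int>" "w = a + src e" "z \<in> (+) a ` path_image (lift e)"
    have "b + z \<in> (+) (b + a) ` path_image (lift e)" using e(4) by (auto simp: add.assoc)
    moreover have "b + w = (b + a) + src e" using e(3) by (simp only: add.assoc)
    ultimately show ?thesis 
      using Ints2_add[OF b e(2)] e(1) by (intro disjI2 bexI[of _ e] bexI[of _ "b + a"] conjI)
  qed simp
  with walk_translate[OF w b] show ?thesis unfolding walk_component_def by (intro CollectI exI conjI)
qed

lemma walk_component_path:
  assumes "walk F u g w" "F \<subseteq> Eh"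
  shows "\<exists>p. path p \<and> pathstart p = u \<and> pathfinish p = w \<and> path_image p \<subseteq> walk_component F u"
  using assms
proof (induction rule: walk.induct)
  case stay
  have "u \<in> walk_component F u"
    unfolding walk_component_def using walk.stay[OF stay(1)] by blast
  then show ?case by (intro exI[of _ "linepath u u"]) (simp add: path_def pathstart_def pathfinish_def)
next
  case (forward g a e)
  then obtain p where p: "path p" "pathstart p = u" "pathfinish p = a + src e" "path_image p \<subseteq> walk_component F u"
    by blast
  define q where "q = (+) a \<circ> lift e"
  have e: "e \<in> Eh" using forward by blast
  have q: "path q" "pathstart q = a + src e" "pathfinish q = a + tgt e" "path_image q = (+) a ` path_image (lift e)"
    using arc_imp_path[OF lift_props(1)[OF e]]
    by (simp_all add: q_def path_translation_eq pathstart_translation pathfinish_translation path_image_translation src_def tgt_def)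
  have "path_image q \<subseteq> walk_component F u"
    unfolding q(4) walk_component_def using forward.hyps by blast
  with p q show ?case
    by (intro exI[of _ "p +++ q"]) (simp add: path_image_join)
next
  case (backward g a e)
  then obtain p where p: "path p" "pathstart p = u" "pathfinish p = a + tgt e" "path_image p \<subseteq> walk_component F u"
    by blast
  define q where "q = reversepath ((+) a \<circ> lift e)"
  have e: "e \<in> Eh" using backward by blast
  have q: "path q" "pathstart q = a + tgt e" "pathfinish q = a + src e" "path_image q = (+) a ` path_image (lift e)"
    using arc_imp_path[OF lift_props(1)[OF e]]
    by (simp_all add: q_def path_translation_eq pathstart_translation pathfinish_translation path_image_translation src_def tgt_def)
  \<comment> \<open>The white end is reached by the backward step itself, which puts the edge into
    the component.\<close>
  have "path_image q \<subseteq> walk_component F u"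
    unfolding q(4) walk_component_def using walk.backward[OF backward.hyps] backward.hyps(2,3) by blast
  with p q show ?case
    by (intro exI[of _ "p +++ q"]) (simp add: path_image_join)
qed

lemma walk_component_vertex:
  assumes "z \<in> walk_component F u" "z \<in> V" "F \<subseteq> Eh"
  shows "\<exists>g. walk F u g z"
proof -
  from assms obtain g w where w: "walk F u g w"
    and z: "z = w \<or> (\<exists>e\<in>F. \<exists>a\<in>\<int> \<times> \<int>. w = a + src e \<and> z \<in> (+) a ` path_image (lift e))"
    unfolding walk_component_def by (elim CollectE exE conjE)
  from z show ?thesis
  proof (elim disjE bexE conjE)
    fix e a assume e: "e \<in> F" "a \<in> \<int> \<times> \<int>" "w = a + src e" "z \<in> (+) a ` path_image (lift e)"
    have "z = a + src e \<or> z = a + tgt e"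
      using translated_lift_vertices[OF _ e(2,4) assms(2)] e(1) assms(3) by blast
    then show ?thesis
    proof
      assume "z = a + src e"
      then show ?thesis using w e(3) by auto
    next
      assume "z = a + tgt e"
      then show ?thesis using walk.forward[OF w[unfolded e(3)] e(1,2)] by auto
    qed
  qed (use w in auto)
qed

text \<open>Embeddedness turns a common point into a common vertex: edges meeting off the vertices
  coincide, and a vertex on an edge is one of its ends.\<close>

lemma walk_components_meet:
  assumes "z \<in> walk_component F u" "z \<in> walk_component F w" "F \<subseteq> Eh"
  shows "\<exists>g. walk F u g w"
proof -
  have "\<exists>y g g'. walk F u g y \<and> walk F w g' y"
  proof (cases "z \<in> V")
    case True
    then show ?thesis using walk_component_vertex assms by blast
  next
    case False
    have edge: "\<exists>g e a. e \<in> F \<and> a \<in> \<int> \<times> \<int> \<and> walk F v g (a + src e) \<and> z \<in> (+) a ` path_image (lift e)"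
      if z: "z \<in> walk_component F v" for v
    proof -
      from z obtain g y where y: "walk F v g y"
        and z: "z = y \<or> (\<exists>e\<in>F. \<exists>a\<in>\<int> \<times> \<int>. y = a + src e \<and> z \<in> (+) a ` path_image (lift e))"
        unfolding walk_component_def by (elim CollectE exE conjE)
      have "z \<noteq> y" using walk_end_in_V[OF y assms(3)] False by metis
      with z y show ?thesis by blast
    qed
    from edge[OF assms(1)] obtain g e a where 1: "e \<in> F" "a \<in> \<int> \<times> \<int>" "walk F u g (a + src e)"
      "z \<in> (+) a ` path_image (lift e)" by (elim exE conjE)
    from edge[OF assms(2)] obtain g' e' a' where 2: "e' \<in> F" "a' \<in> \<int> \<times> \<int>" "walk F w g' (a' + src e')"
      "z \<in> (+) a' ` path_image (lift e')" by (elim exE conjE)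
    have e: "e \<in> Eh" "e' \<in> Eh" using 1(1) 2(1) assms(3) by blast+
    \<comment> \<open>The two edges are equal as sets, so the white end of the first lies in the
      component of \<open>w\<close> as well.\<close>
    have "(+) a ` path_image (lift e) = (+) a' ` path_image (lift e')"
      by (rule edges_meet_in_V[OF translate_E[OF 1(2) lift_props(2)[OF e(1)]]
            translate_E[OF 2(2) lift_props(2)[OF e(2)]] 1(4) 2(4) False])
    moreover have "a + src e \<in> (+) a ` path_image (lift e)"
      unfolding src_def by (intro imageI pathstart_in_path_image)
    ultimately have mem: "a + src e \<in> (+) a' ` path_image (lift e')" by simp
    have "a + src e \<in> walk_component F w"
      unfolding walk_component_def using 2 mem by blast
    from walk_component_vertex[OF this walk_end_in_V[OF 1(3) assms(3)] assms(3)] 1(3)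
    show ?thesis by blast
  qed
  then obtain y g g' where "walk F u g y" "walk F w g' y" by (elim exE conjE)
  from walk_trans[OF this(1) walk_sym[OF this(2) assms(3)]] show ?thesis by (intro exI)
qed

lemma closed_walk_multiple:
  assumes "walk F u g (h + u)" "h \<in> \<int> \<times> \<int>" "F \<subseteq> Eh"
  shows "\<exists>g'. walk F u g' (of_int k *\<^sub>R h + u)"
proof (induction k rule: int_induct[of _ 0])
  case base
  show ?case using walk.stay[OF walk_start_in_V[OF assms(1)]] by auto
next
  case (step1 i)
  from this(2) obtain g' where g': "walk F u g' (of_int i *\<^sub>R h + u)" ..
  have "of_int i *\<^sub>R h \<in> \<int> \<times> \<int>" using assms(2) by (intro Ints2_scaleR) simp_all
  from walk_trans[OF g' walk_translate[OF assms(1) this]]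
  show ?case by (intro exI) (simp add: algebra_simps)
next
  case (step2 i)
  from this(2) obtain g' where g': "walk F u g' (of_int i *\<^sub>R h + u)" ..
  have "of_int (i - 1) *\<^sub>R h \<in> \<int> \<times> \<int>" using assms(2) by (intro Ints2_scaleR) simp_all
  from walk_translate[OF walk_sym[OF assms(1,3)] this]
  have "walk F (of_int i *\<^sub>R h + u) (\<lambda>e. - g e) (of_int (i - 1) *\<^sub>R h + u)"
    by (simp add: algebra_simps)
  from walk_trans[OF g' this] show ?case by (intro exI)
qed

text \<open>Repeating the closed walk reaches every translate of \<open>u\<close> by a multiple of
  \<open>h\<close>, so the component contains all these translates of the path.\<close>

lemma translated_path_in_component:
  assumes "walk F u g (h + u)" "h \<in> \<int> \<times> \<int>" "F \<subseteq> Eh" "path_image p \<subseteq> walk_component F u"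
    "z \<in> (+) (of_int k *\<^sub>R h) ` path_image p"
  shows "z \<in> walk_component F u"
proof -
  obtain y where y: "y \<in> path_image p" "z = of_int k *\<^sub>R h + y" using assms(5) by (elim imageE)
  have "y \<in> walk_component F u" using y(1) assms(4) by (rule subsetD[rotated])
  moreover have "of_int k *\<^sub>R h \<in> \<int> \<times> \<int>" using assms(2) by (intro Ints2_scaleR) simp_all
  ultimately have "z \<in> walk_component F (of_int k *\<^sub>R h + u)"
    unfolding y(2) by (rule walk_component_translate)
  moreover from closed_walk_multiple[OF assms(1-3)] obtain g' where "walk F u g' (of_int k *\<^sub>R h + u)" ..
  ultimately show ?thesis using walk_component_subset by (meson subsetD)
qed

text \<open>The traces of the walks, extended periodically, cross, and a crossing joins their
  components.\<close>

lemma transverse_closed_walks_connected: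
  assumes w1: "walk F u1 g1 (h1 + u1)" and w2: "walk F u2 g2 (h2 + u2)"
    and h: "h1 \<in> \<int> \<times> \<int>" "h2 \<in> \<int> \<times> \<int>" and F: "F \<subseteq> Eh" and det: "det2 h1 h2 \<noteq> 0"
  shows "\<exists>g. walk F u1 g u2"
proof -
  from walk_component_path[OF w1 F] obtain p1 where p1: "path p1" "pathstart p1 = u1" "pathfinish p1 = h1 + u1"
    "path_image p1 \<subseteq> walk_component F u1" by (elim exE conjE)
  from walk_component_path[OF w2 F] obtain p2 where p2: "path p2" "pathstart p2 = u2" "pathfinish p2 = h2 + u2"
    "path_image p2 \<subseteq> walk_component F u2" by (elim exE conjE)
  have "h1 = pathfinish p1 - pathstart p1" "h2 = pathfinish p2 - pathstart p2" using p1 p2 by simp_all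
  from periodic_paths_cross[OF p1(1) p2(1) this det]
  obtain k l :: int where "(+) (of_int k *\<^sub>R h1) ` path_image p1 \<inter> (+) (of_int l *\<^sub>R h2) ` path_image p2 \<noteq> {}" .
  then obtain z where z: "z \<in> (+) (of_int k *\<^sub>R h1) ` path_image p1" "z \<in> (+) (of_int l *\<^sub>R h2) ` path_image p2"
    by blast
  show ?thesis
    by (rule walk_components_meet[OF translated_path_in_component[OF w1 h(1) F p1(4) z(1)]
          translated_path_in_component[OF w2 h(2) F p2(4) z(2)] F])
qed

text \<open>The periodic trace meets its own translate by \<open>t *\<^sub>R h\<close>, so the
  components of \<open>u\<close> and of its translate coincide.\<close>

lemma closed_walk_fraction:
  assumes w: "walk F u g (h + u)" and h: "h \<in> \<int> \<times> \<int>" "h \<noteq> 0" and F: "F \<subseteq> Eh"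
    and t: "0 < t" "t < 1" "t *\<^sub>R h \<in> \<int> \<times> \<int>"
  shows "\<exists>g. walk F u g (t *\<^sub>R h + u)"
proof -
  from walk_component_path[OF w F] obtain p where p: "path p" "pathstart p = u" "pathfinish p = h + u"
    "path_image p \<subseteq> walk_component F u" by (elim exE conjE)
  have "h = pathfinish p - pathstart p" using p by simp
  from periodic_path_meets_translate[OF p(1) this h(2) t(1,2)]
  obtain k l :: int where "(+) (of_int k *\<^sub>R h) ` path_image p \<inter> (+) (t *\<^sub>R h + of_int l *\<^sub>R h) ` path_image p \<noteq> {}" .
  then obtain z where z: "z \<in> (+) (of_int k *\<^sub>R h) ` path_image p" "z \<in> (+) (t *\<^sub>R h + of_int l *\<^sub>R h) ` path_image p"
    by blast
  from z(2) obtain y where y: "y \<in> path_image p" "z = (t *\<^sub>R h + of_int l *\<^sub>R h) + y" by (elim imageE)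
  have "of_int l *\<^sub>R h + y \<in> walk_component F u"
    by (rule translated_path_in_component[OF w h(1) F p(4)]) (use y in blast)
  from walk_component_translate[OF this t(3)]
  have "z \<in> walk_component F (t *\<^sub>R h + u)" unfolding y(2) by (simp only: add.assoc)
  then show ?thesis
    by (rule walk_components_meet[OF translated_path_in_component[OF w h(1) F p(4) z(1)] _ F])
qed

subsection \<open>Fractional matchings\<close>

text \<open>If \<open>e\<close> were a bridge of \<open>F\<close>, summing the signed vertex sums
  over the side of its black end would leave \<open>x e\<close> plus integers, and
  \<open>x e\<close> would be an integer.\<close>

lemma nonintegral_edge_on_closed_walk:
  assumes x: "\<And>v. v \<in> Vh \<Longrightarrow> vertex_sum x v \<in> \<int>"
    and F: "F \<subseteq> Eh" "\<And>e. e \<in> Eh \<Longrightarrow> e \<notin> F \<Longrightarrow> x e \<in> \<int>"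
    and e: "e \<in> F" "x e \<notin> \<int>"
  shows "\<exists>g a. a \<in> \<int> \<times> \<int> \<and> walk F (src e) g (a + src e) \<and> g e = 1"
proof -
  have eE: "e \<in> Eh" and F': "F - {e} \<subseteq> Eh" using e(1) F(1) by blast+
  \<comment> \<open>Restricting \<open>K\<close> to these finitely many vertices keeps the sums over
    \<open>K\<close> finite.\<close>
  define ends where "ends = (\<lambda>e. torus_proj (src e)) ` Eh \<union> (\<lambda>e. torus_proj (tgt e)) ` Eh"
  define K where "K = {v \<in> ends. \<exists>g w. walk (F - {e}) (tgt e) g w \<and> v = torus_proj w}"
  have srcK: "torus_proj (src e) \<in> K"
  proof (rule ccontr)
    assume notin: "torus_proj (src e) \<notin> K"
    have finK: "finite K" unfolding K_def ends_def using finite_torus_edges by simp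
    have KV: "K \<subseteq> Vh"
      unfolding K_def ends_def torus_vertices_def using src_tgt_in_V by blast
    have ends: "torus_proj (src e') \<in> ends" "torus_proj (tgt e') \<in> ends" if "e' \<in> Eh" for e'
      unfolding ends_def using that by blast+
    have tgtK: "torus_proj (tgt e) \<in> K"
      unfolding K_def using ends(2)[OF eE] walk.stay[OF src_tgt_in_V(2)[OF eE]] by blast
    \<comment> \<open>No edge of \<open>F\<close> other than \<open>e\<close> leaves
      \<open>K\<close>, so these edges cancel in the sum below.\<close>
    have both: "torus_proj (src e') \<in> K \<longleftrightarrow> torus_proj (tgt e') \<in> K" if e': "e' \<in> F" "e' \<noteq> e" for e'
    proof
      have e'': "e' \<in> Eh" "e' \<in> F - {e}" using e' F(1) by blast+
      {
        assume "torus_proj (src e') \<in> K"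
        then obtain g w where w: "walk (F - {e}) (tgt e) g w" "torus_proj (src e') = torus_proj w"
          unfolding K_def by blast
        then have a: "w - src e' \<in> \<int> \<times> \<int>" by (metis torus_proj_eq_iff)
        have "walk (F - {e}) (tgt e) g ((w - src e') + src e')" using w(1) by simp
        from walk.forward[OF this e''(2) a] torus_proj_add_Ints[OF a, of "tgt e'", symmetric]
        show "torus_proj (tgt e') \<in> K" unfolding K_def using ends(2)[OF e''(1)] by blast
      next
        assume "torus_proj (tgt e') \<in> K"
        then obtain g w where w: "walk (F - {e}) (tgt e) g w" "torus_proj (tgt e') = torus_proj w"
          unfolding K_def by blast
        then have a: "w - tgt e' \<in> \<int> \<times> \<int>" by (metis torus_proj_eq_iff)
        have "walk (F - {e}) (tgt e) g ((w - tgt e') + tgt e')" using w(1) by simp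
        from walk.backward[OF this e''(2) a] torus_proj_add_Ints[OF a, of "src e'", symmetric]
        show "torus_proj (src e') \<in> K" unfolding K_def using ends(1)[OF e''(1)] by blast
      }
    qed
    let ?c = "\<lambda>e'. of_bool (torus_proj (tgt e') \<in> K) - of_bool (torus_proj (src e') \<in> K) :: real"
    \<comment> \<open>Double counting: the total net inflow of \<open>K\<close> is computed by
      vertices and by edges.\<close>
    have "(\<Sum>v\<in>K. vertex_sign v * vertex_sum x v) = (\<Sum>v\<in>K. \<Sum>e'\<in>Eh. x e' * (vertex_sign v * of_bool (v \<in> e')))"
    proof (rule sum.cong[OF refl])
      fix v
      have "vertex_sum x v = (\<Sum>e'\<in>Eh. x e' * of_bool (v \<in> e'))"
        unfolding vertex_sum_def using finite_torus_edges
        by (simp add: sum.inter_filter of_bool_def if_distrib cong: if_cong)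
      then show "vertex_sign v * vertex_sum x v = (\<Sum>e'\<in>Eh. x e' * (vertex_sign v * of_bool (v \<in> e')))"
        by (simp add: sum_distrib_left mult.left_commute)
    qed
    also have "\<dots> = (\<Sum>e'\<in>Eh. \<Sum>v\<in>K. x e' * (vertex_sign v * of_bool (v \<in> e')))"
      by (rule sum.swap)
    also have "\<dots> = (\<Sum>e'\<in>Eh. x e' * ?c e')"
    proof (rule sum.cong[OF refl])
      fix e' assume e': "e' \<in> Eh"
      have "(\<Sum>v\<in>K. x e' * (vertex_sign v * of_bool (v \<in> e')))
          = (\<Sum>v\<in>K. x e' * (of_bool (v = torus_proj (tgt e')) - of_bool (v = torus_proj (src e'))))"
      proof (rule sum.cong[OF refl])
        fix v assume "v \<in> K"
        then have "v \<in> Vh" using KV by (rule subsetD[rotated])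
        from vertex_sign_incident[OF this e']
        show "x e' * (vertex_sign v * of_bool (v \<in> e')) =
            x e' * (of_bool (v = torus_proj (tgt e')) - of_bool (v = torus_proj (src e')))" by simp
      qed
      also have "\<dots> = x e' * ?c e'"
        using finK by (simp add: sum_distrib_left[symmetric] sum_subtractf of_bool_def)
      finally show "(\<Sum>v\<in>K. x e' * (vertex_sign v * of_bool (v \<in> e'))) = x e' * ?c e'" .
    qed
    also have "\<dots> = x e * ?c e + (\<Sum>e'\<in>Eh - {e}. x e' * ?c e')"
      using finite_torus_edges eE by (rule sum.remove)
    also have "x e * ?c e = x e" using notin tgtK by simp
    finally have eq: "x e = (\<Sum>v\<in>K. vertex_sign v * vertex_sum x v) - (\<Sum>e'\<in>Eh - {e}. x e' * ?c e')"
      by simp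
    have "(\<Sum>v\<in>K. vertex_sign v * vertex_sum x v) \<in> \<int>"
    proof (intro Ints_sum Ints_mult)
      fix v assume "v \<in> K"
      then show "vertex_sum x v \<in> \<int>" using KV x by (meson subsetD)
      show "vertex_sign v \<in> \<int>" by (simp add: vertex_sign_def)
    qed
    moreover have "(\<Sum>e'\<in>Eh - {e}. x e' * ?c e') \<in> \<int>"
    proof (rule Ints_sum)
      fix e' assume e': "e' \<in> Eh - {e}"
      show "x e' * ?c e' \<in> \<int>"
      proof (cases "e' \<in> F")
        case True
        then show ?thesis using both[OF True] e' by simp
      next
        case False
        then have "x e' \<in> \<int>" using F(2) e' by blast
        then show ?thesis by (intro Ints_mult Ints_diff) auto
      qed
    qed
    ultimately have "x e \<in> \<int>" unfolding eq by (rule Ints_diff)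
    then show False using e(2) by simp
  qed
  then obtain g w where w: "walk (F - {e}) (tgt e) g w" "torus_proj (src e) = torus_proj w"
    unfolding K_def by blast
  then have a: "w - src e \<in> \<int> \<times> \<int>" by (metis torus_proj_eq_iff)
  \<comment> \<open>The closed walk crosses \<open>e\<close> first and returns inside
    \<open>F - {e}\<close>, so its flow on \<open>e\<close> is exactly 1.\<close>
  have 1: "walk F (src e) (\<lambda>e'. 0 + of_bool (e' = e)) (tgt e)"
    using walk.forward[of F "src e" "\<lambda>_. 0" 0 e] walk.stay[OF src_tgt_in_V(1)[OF eE], of F] e(1) Ints2_zero by simp
  have 2: "walk F (tgt e) g ((w - src e) + src e)"
    using walk_mono[OF w(1) Diff_subset] by simp
  have "walk F (src e) (\<lambda>e'. 0 + of_bool (e' = e) + g e') ((w - src e) + src e)"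
    by (rule walk_trans[OF 1 2])
  moreover have "0 + of_bool (e = e) + g e = 1" using walk_support[OF w(1), of e] by simp
  ultimately show ?thesis using a
    by (intro exI[of _ "\<lambda>e'. 0 + of_bool (e' = e) + g e'"] exI[of _ "w - src e"] conjI)
qed

text \<open>In the flux, the representative of each vertex is multiplied by the vertex sum, which is
  zero; only integral multiples of lattice vectors remain.\<close>

lemma flux_integral_flow:
  assumes y: "\<And>e. e \<in> Eh \<Longrightarrow> y e \<in> \<int>" and v: "\<And>v. v \<in> Vh \<Longrightarrow> vertex_sum y v = 0"
  shows "flux y \<in> \<int> \<times> \<int>"
proof -
  from torus_representatives obtain rep :: "torus_point \<Rightarrow> plane" and k :: "plane \<Rightarrow> int \<times> int"
    where "\<forall>u. u = lattice_point (k u) + rep (torus_proj u)" by (elim exE)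
  note rep = this[rule_format]
  have zero: "(\<Sum>e\<in>Eh. y e *\<^sub>R rep (torus_proj (r e))) = 0"
    if r: "\<And>e. e \<in> Eh \<Longrightarrow> r e \<in> V"
      "\<And>e e'. e \<in> Eh \<Longrightarrow> e' \<in> Eh \<Longrightarrow> torus_proj (r e') \<in> e \<longleftrightarrow> torus_proj (r e') = torus_proj (r e)" for r
  proof -
    have "(\<Sum>e\<in>Eh. y e *\<^sub>R rep (torus_proj (r e)))
        = (\<Sum>v\<in>(\<lambda>e. torus_proj (r e)) ` Eh. \<Sum>e\<in>{e \<in> Eh. torus_proj (r e) = v}. y e *\<^sub>R rep (torus_proj (r e)))"
      using finite_torus_edges by (intro sum.group[symmetric]) auto
    also have "\<dots> = (\<Sum>v\<in>(\<lambda>e. torus_proj (r e)) ` Eh. vertex_sum y v *\<^sub>R rep v)"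
    proof (rule sum.cong[OF refl])
      fix v assume "v \<in> (\<lambda>e. torus_proj (r e)) ` Eh"
      then obtain e' where e': "e' \<in> Eh" "v = torus_proj (r e')" by (elim imageE)
      have "{e \<in> Eh. torus_proj (r e) = v} = {e \<in> Eh. v \<in> e}"
        unfolding e'(2) using r(2)[OF _ e'(1)] by (intro Collect_cong) metis
      moreover have "(\<Sum>e\<in>{e \<in> Eh. torus_proj (r e) = v}. y e *\<^sub>R rep (torus_proj (r e)))
          = (\<Sum>e\<in>{e \<in> Eh. torus_proj (r e) = v}. y e *\<^sub>R rep v)"
        by (rule sum.cong) simp_all
      ultimately show "(\<Sum>e\<in>{e \<in> Eh. torus_proj (r e) = v}. y e *\<^sub>R rep (torus_proj (r e))) = vertex_sum y v *\<^sub>R rep v"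
        by (simp only: vertex_sum_def scaleR_sum_left)
    qed
    also have "\<dots> = 0"
    proof (rule sum.neutral, rule ballI)
      fix v assume "v \<in> (\<lambda>e. torus_proj (r e)) ` Eh"
      then have "v \<in> Vh" using r(1) unfolding torus_vertices_def by blast
      then show "vertex_sum y v *\<^sub>R rep v = 0" using v by simp
    qed
    finally show ?thesis .
  qed
  have zs: "(\<Sum>e\<in>Eh. y e *\<^sub>R rep (torus_proj (src e))) = 0"
    by (rule zero[OF src_tgt_in_V(1) incident_white_iff[OF lift_props(4)]])
  have zt: "(\<Sum>e\<in>Eh. y e *\<^sub>R rep (torus_proj (tgt e))) = 0"
    by (rule zero[OF src_tgt_in_V(2) incident_black_iff[OF lift_props(5)]])
  have "disp e = (lattice_point (k (tgt e)) + rep (torus_proj (tgt e))) -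
       (lattice_point (k (src e)) + rep (torus_proj (src e)))" for e
    unfolding disp_def rep[symmetric] ..
  then have "flux y = (\<Sum>e\<in>Eh. y e *\<^sub>R (lattice_point (k (tgt e)) - lattice_point (k (src e))))
      + (\<Sum>e\<in>Eh. y e *\<^sub>R rep (torus_proj (tgt e))) - (\<Sum>e\<in>Eh. y e *\<^sub>R rep (torus_proj (src e)))"
    unfolding flux_def by (simp add: scaleR_add_right scaleR_diff_right sum.distrib sum_subtractf)
  also have "\<dots> = (\<Sum>e\<in>Eh. y e *\<^sub>R (lattice_point (k (tgt e)) - lattice_point (k (src e))))"
    unfolding zs zt by simp
  also have "\<dots> \<in> \<int> \<times> \<int>"
    by (intro Ints2_sum Ints2_scaleR Ints2_diff lattice_point_in_Ints y)
  finally show ?thesis .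
qed

text \<open>The flux is not normalised; the displacement of the reference matching is subtracted
  only when the polygon is considered.\<close>

definition fractional_matchings :: "plane \<Rightarrow> (torus_point set \<Rightarrow> real) set" where
  "fractional_matchings p = {x. (\<forall>e\<in>Eh. 0 \<le> x e \<and> x e \<le> 1) \<and> (\<forall>v\<in>Vh. vertex_sum x v = 1) \<and> flux x = p}"

definition nonintegral :: "(torus_point set \<Rightarrow> real) \<Rightarrow> torus_point set set" where
  "nonintegral x = {e \<in> Eh. x e \<notin> \<int>}"

text \<open>Adding multiples of a nonzero such flow keeps vertex sums and flux, and can be continued
  until some entry reaches 0 or 1. That would leave fewer nonintegral edges.\<close>

lemma flow_vanishes_on_minimal_support:
  assumes x: "x \<in> fractional_matchings p"
    and min: "\<And>y. y \<in> fractional_matchings p \<Longrightarrow> card (nonintegral x) \<le> card (nonintegral y)"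
    and f: "\<And>e. e \<in> Eh \<Longrightarrow> e \<notin> nonintegral x \<Longrightarrow> f e = 0" "\<And>v. v \<in> Vh \<Longrightarrow> vertex_sum f v = 0" "flux f = 0"
    and e: "e \<in> Eh"
  shows "f e = 0"
proof (rule ccontr)
  assume "f e \<noteq> 0"
  define S where "S = {e \<in> Eh. f e \<noteq> 0}"
  have S: "finite S" "S \<noteq> {}" using finite_torus_edges e \<open>f e \<noteq> 0\<close> by (auto simp: S_def)
  have x01: "0 \<le> x e'" "x e' \<le> 1" if "e' \<in> Eh" for e'
    using x that unfolding fractional_matchings_def by blast+
  have SN: "S \<subseteq> nonintegral x" using f(1) unfolding S_def by blast
  \<comment> \<open>The largest step for which the entry at \<open>e\<close> stays between 0 and 1;
    the smallest of these is taken.\<close>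
  define r where "r e = (if f e > 0 then (1 - x e) / f e else x e / (- f e))" for e
  define l where "l = Min (r ` S)"
  have "l \<in> r ` S" unfolding l_def using S by (intro Min_in) auto
  then obtain e1 where e1: "e1 \<in> S" "l = r e1" by (elim imageE)
  have le: "l \<le> r e'" if "e' \<in> S" for e' unfolding l_def using S that by (intro Min_le) auto
  have r0: "0 \<le> r e'" if "e' \<in> Eh" for e' unfolding r_def using x01[OF that] by (auto intro: divide_nonneg_nonpos)
  have l0: "0 \<le> l" using r0 e1 unfolding S_def by blast
  define y where "y e = x e + l * f e" for e
  have y01: "0 \<le> y e' \<and> y e' \<le> 1" if e': "e' \<in> Eh" for e'
  proof (cases "f e' = 0")
    case True then show ?thesis using x01[OF e'] by (simp add: y_def)
  next
    case False
    then have le': "l \<le> r e'" using le e' unfolding S_def by blast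
    show ?thesis
    proof (cases "f e' > 0")
      case True
      then have "l * f e' \<le> 1 - x e'" using le' by (simp add: r_def pos_le_divide_eq)
      moreover have "0 \<le> l * f e'" using l0 True by simp
      ultimately show ?thesis using x01[OF e'] unfolding y_def by linarith
    next
      case neg: False
      then have "f e' < 0" using False by simp
      then have "l * (- f e') \<le> x e'" using le' neg by (simp only: r_def if_False pos_le_divide_eq neg_0_less_iff_less)
      moreover have "l * f e' \<le> 0" using l0 \<open>f e' < 0\<close> by (simp add: mult_nonneg_nonpos)
      ultimately show ?thesis using x01[OF e'] unfolding y_def by (simp add: algebra_simps)
    qed
  qed
  have yfm: "y \<in> fractional_matchings p"
    using x y01 f(2,3) unfolding fractional_matchings_def y_def
    by (simp add: vertex_sum_add vertex_sum_scale flux_add flux_scale)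
  \<comment> \<open>The edge with the smallest step hits its bound.\<close>
  have "y e1 = 0 \<or> y e1 = 1"
    using e1 unfolding y_def S_def by (auto simp: r_def)
  then have "e1 \<notin> nonintegral y" unfolding nonintegral_def by auto
  moreover have "nonintegral y \<subseteq> nonintegral x"
  proof
    fix e' assume e': "e' \<in> nonintegral y"
    show "e' \<in> nonintegral x"
    proof (rule ccontr)
      assume n: "e' \<notin> nonintegral x"
      then have "f e' = 0" using f(1) e' unfolding nonintegral_def by blast
      then show False using n e' unfolding nonintegral_def y_def by simp
    qed
  qed
  ultimately have "nonintegral y \<subset> nonintegral x" using e1(1) SN by blast
  then have "card (nonintegral y) < card (nonintegral x)"
    using finite_torus_edges by (intro psubset_card_mono) (auto simp: nonintegral_def)
  then show False using min[OF yfm] by simp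
qed

text \<open>The vector \<open>c\<close> fixes the fluxes of integral vectors modulo the lattice.
  Subtracting multiples of one or two closed-walk flows makes \<open>x\<close> integral; a walk
  realising the subtracted flux then equates a nonintegral number with an integer.\<close>

lemma minimal_fractional_matching_integral:
  assumes x: "x \<in> fractional_matchings p"
    and min: "\<And>y. y \<in> fractional_matchings p \<Longrightarrow> card (nonintegral x) \<le> card (nonintegral y)"
    and c: "\<And>e. e \<in> Eh \<Longrightarrow> c e \<in> \<int>" "\<And>v. v \<in> Vh \<Longrightarrow> vertex_sum c v = 1" "p - flux c \<in> \<int> \<times> \<int>"
  shows "nonintegral x = {}"
proof (rule ccontr)
  define N where "N = nonintegral x"
  assume "nonintegral x \<noteq> {}"
  then obtain e1 where e1: "e1 \<in> N" unfolding N_def by blast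
  have N: "N \<subseteq> Eh" unfolding N_def nonintegral_def by blast
  have N_iff: "e \<in> N \<longleftrightarrow> x e \<notin> \<int>" if "e \<in> Eh" for e
    using that unfolding N_def nonintegral_def by blast
  have e1E: "e1 \<in> Eh" and xe1: "x e1 \<notin> \<int>" using e1 N N_iff by blast+
  have xv: "vertex_sum x v = 1" if "v \<in> Vh" for v
    using x that unfolding fractional_matchings_def by blast
  have xp: "flux x = p" using x unfolding fractional_matchings_def by blast
  have van: "f e = 0"
    if "\<And>e. e \<in> Eh \<Longrightarrow> e \<notin> N \<Longrightarrow> f e = 0" "\<And>v. v \<in> Vh \<Longrightarrow> vertex_sum f v = 0" "flux f = 0" "e \<in> Eh" for f e
    using flow_vanishes_on_minimal_support[OF x min that[unfolded N_def]] .
  \<comment> \<open>The difference \<open>y - c\<close> is an integral flow, so its flux is a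
    lattice vector.\<close>
  have lattice: "p - flux y \<in> \<int> \<times> \<int>"
    if y: "\<And>e. e \<in> Eh \<Longrightarrow> y e \<in> \<int>" "\<And>v. v \<in> Vh \<Longrightarrow> vertex_sum y v = 1" for y
  proof -
    have "flux (\<lambda>e. y e - c e) \<in> \<int> \<times> \<int>"
      by (rule flux_integral_flow) (use y c in \<open>simp_all add: vertex_sum_diff\<close>)
    from Ints2_diff[OF c(3) this] show ?thesis by (simp add: flux_diff)
  qed
  have Nint: "x e \<in> \<int>" if "e \<in> Eh" "e \<notin> N" for e using that N_iff by blast
  from nonintegral_edge_on_closed_walk[of x N e1] xv N Nint e1 xe1
  obtain g1 a1 where g1: "a1 \<in> \<int> \<times> \<int>" "walk N (src e1) g1 (a1 + src e1)" "g1 e1 = 1" by auto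
  define f1 where "f1 e = real_of_int (g1 e)" for e
  have f1: "f1 e1 = 1" "\<And>e. e \<notin> N \<Longrightarrow> f1 e = 0" "flux f1 = a1" "\<And>v. v \<in> Vh \<Longrightarrow> vertex_sum f1 v = 0"
    unfolding f1_def
    using g1(3) walk_support[OF g1(2)] walk_flux[OF g1(2) N] closed_walk_vertex_sum[OF g1(2,1) N] by simp_all
  \<comment> \<open>Otherwise \<open>f1\<close> would be a flow of zero flux in \<open>N\<close>,
    hence zero, although \<open>f1 e1 = 1\<close>.\<close>
  have a1: "a1 \<noteq> 0"
  proof
    assume "a1 = 0"
    have "f1 e1 = 0"
    proof (rule van)
      show "flux f1 = 0" using f1(3) \<open>a1 = 0\<close> by simp
    qed (simp_all add: f1(2,4) e1E)
    then show False using f1(1) by simp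
  qed
  define x1 where "x1 e = x e - x e1 * f1 e" for e
  have x1v: "vertex_sum x1 v = 1" if "v \<in> Vh" for v
    unfolding x1_def using xv[OF that] f1(4)[OF that] by (simp add: vertex_sum_diff vertex_sum_scale)
  have x1p: "flux x1 = p - x e1 *\<^sub>R a1"
    unfolding x1_def by (simp add: flux_diff flux_scale xp f1(3))
  have x1e1: "x1 e1 = 0" by (simp add: x1_def f1(1))
  have x1N: "x1 e \<in> \<int>" if "e \<in> Eh" "e \<notin> N" for e
    using Nint[OF that] f1(2)[OF that(2)] by (simp add: x1_def)
  show False
  proof (cases "\<forall>e\<in>Eh. x1 e \<in> \<int>")
    case True
    have "p - flux x1 \<in> \<int> \<times> \<int>" using True x1v by (intro lattice) blast+
    then have ta: "x e1 *\<^sub>R a1 \<in> \<int> \<times> \<int>" by (simp only: x1p diff_diff_eq2 add_diff_cancel_left')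
    \<comment> \<open>Passing to the fractional part puts the factor strictly between 0 and 1, and
      changes the vector by a lattice vector.\<close>
    define t where "t = frac (x e1)"
    have t: "0 < t" "t < 1" unfolding t_def using xe1 by (simp_all add: frac_gt_0_iff frac_lt_1)
    have "of_int \<lfloor>x e1\<rfloor> *\<^sub>R a1 \<in> \<int> \<times> \<int>" using g1(1) by (intro Ints2_scaleR) simp_all
    from Ints2_diff[OF ta this] have "t *\<^sub>R a1 \<in> \<int> \<times> \<int>"
      unfolding t_def frac_def by (simp only: scaleR_diff_left)
    note ta' = this
    from closed_walk_fraction[OF g1(2,1) a1 N t this]
    obtain g where g: "walk N (src e1) g (t *\<^sub>R a1 + src e1)" ..
    \<comment> \<open>Both flows live in \<open>N\<close> and have the same flux, so they
      agree.\<close>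
    have "real_of_int (g e1) - t * f1 e1 = 0"
    proof (rule van)
      show "flux (\<lambda>e. real_of_int (g e) - t * f1 e) = 0"
        using walk_flux[OF g N] by (simp add: flux_diff flux_scale f1(3))
    qed (use walk_support[OF g] closed_walk_vertex_sum[OF g ta' N] f1 e1E in
        \<open>simp_all add: vertex_sum_diff vertex_sum_scale\<close>)
    then have "real_of_int (g e1) = t" using f1(1) by simp
    then have "0 < g e1" "g e1 < 1" using t by linarith+
    then show False by simp
  next
    case False
    then obtain e2 where e2E: "e2 \<in> Eh" and x1e2: "x1 e2 \<notin> \<int>" by blast
    \<comment> \<open>The second walk is made to avoid \<open>e1\<close>, so that
      \<open>f2 e1 = 0\<close> and coefficients can be read off at \<open>e1\<close> first and then
      at \<open>e2\<close>.\<close>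
    define F1 where "F1 = N - {e1}"
    have F1: "F1 \<subseteq> N" "F1 \<subseteq> Eh" using N unfolding F1_def by blast+
    have "e2 \<noteq> e1" using x1e1 x1e2 by auto
    moreover have "e2 \<in> N" using x1N[OF e2E] x1e2 by blast
    ultimately have e2: "e2 \<in> F1" unfolding F1_def by simp
    have x1F1: "x1 e \<in> \<int>" if "e \<in> Eh" "e \<notin> F1" for e
      using that x1N x1e1 unfolding F1_def by (cases "e = e1") auto
    from nonintegral_edge_on_closed_walk[of x1 F1 e2] x1v F1(2) x1F1 e2 x1e2
    obtain g2 a2 where g2: "a2 \<in> \<int> \<times> \<int>" "walk F1 (src e2) g2 (a2 + src e2)" "g2 e2 = 1" by auto
    note g2N = walk_mono[OF g2(2) F1(1)]
    define f2 where "f2 e = real_of_int (g2 e)" for e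
    have f2: "f2 e2 = 1" "\<And>e. e \<notin> F1 \<Longrightarrow> f2 e = 0" "\<And>e. e \<notin> N \<Longrightarrow> f2 e = 0" "flux f2 = a2"
      "\<And>v. v \<in> Vh \<Longrightarrow> vertex_sum f2 v = 0"
      unfolding f2_def
      using g2(3) walk_support[OF g2(2)] walk_support[OF g2N] walk_flux[OF g2N N] closed_walk_vertex_sum[OF g2N g2(1) N]
      by simp_all
    have f2e1: "f2 e1 = 0" by (rule f2(2)) (simp add: F1_def)
    have det: "det2 a1 a2 \<noteq> 0"
    proof
      assume det: "det2 a1 a2 = 0"
      \<comment> \<open>The rotation of \<open>a1\<close> by a right angle, for which
        \<open>det2 a1 z\<close> is the squared length of \<open>a1\<close>. With zero determinant,
        Cramer's identity becomes a linear relation between \<open>a1\<close> and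
        \<open>a2\<close>.\<close>
      define z where "z = (- snd a1, fst a1)"
      have comb: "det2 z a2 * f1 e + det2 a1 z * f2 e = 0" if "e \<in> Eh" for e
      proof (rule van[OF _ _ _ that])
        show "flux (\<lambda>e. det2 z a2 * f1 e + det2 a1 z * f2 e) = 0"
          using det2_cramer[of a1 a2 z] det by (simp add: flux_add flux_scale f1(3) f2(4))
      qed (simp_all add: f1 f2 vertex_sum_add vertex_sum_scale)
      have "det2 z a2 = 0" using comb[OF e1E] f1(1) f2e1 by simp
      then have "det2 a1 z = 0" using comb[OF e2E] f2(1) by simp
      then have "fst a1 * fst a1 + snd a1 * snd a1 = 0" by (simp add: det2_def z_def)
      then show False using a1 by (simp add: prod_eq_iff)
    qed
    define x2 where "x2 e = x1 e - x1 e2 * f2 e" for e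
    have x2v: "vertex_sum x2 v = 1" if "v \<in> Vh" for v
      unfolding x2_def using x1v[OF that] f2(5)[OF that] by (simp add: vertex_sum_diff vertex_sum_scale)
    have x2p: "flux x2 = p - (x e1 *\<^sub>R a1 + x1 e2 *\<^sub>R a2)"
      unfolding x2_def by (simp add: flux_diff flux_scale x1p f2(4))
    \<comment> \<open>A further nonintegral edge would lie on a closed walk avoiding
      \<open>e1\<close> and \<open>e2\<close>. Three fluxes in the plane are dependent, so its flow
      would be a combination of \<open>f1\<close> and \<open>f2\<close>; evaluation at
      \<open>e1\<close> and \<open>e2\<close> makes the coefficients zero.\<close>
    have x2int: "x2 e \<in> \<int>" if "e \<in> Eh" for e
    proof (rule ccontr)
      define F2 where "F2 = F1 - {e2}"
      have F2: "F2 \<subseteq> N" "F2 \<subseteq> Eh" using F1 unfolding F2_def by blast+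
      have x2F2: "x2 e' \<in> \<int>" if "e' \<in> Eh" "e' \<notin> F2" for e'
        using that x1F1 f2(1,2) unfolding F2_def x2_def by (cases "e' = e2") auto
      assume xe: "x2 e \<notin> \<int>"
      then have e: "e \<in> F2" using x2F2[OF that] by blast
      from nonintegral_edge_on_closed_walk[of x2 F2 e] x2v F2(2) x2F2 e xe
      obtain g3 a3 where g3: "a3 \<in> \<int> \<times> \<int>" "walk F2 (src e) g3 (a3 + src e)" "g3 e = 1" by auto
      note g3N = walk_mono[OF g3(2) F2(1)]
      define f3 where "f3 e = real_of_int (g3 e)" for e
      have f3: "f3 e = 1" "\<And>e. e \<notin> F2 \<Longrightarrow> f3 e = 0" "\<And>e. e \<notin> N \<Longrightarrow> f3 e = 0" "flux f3 = a3"
        "\<And>v. v \<in> Vh \<Longrightarrow> vertex_sum f3 v = 0"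
        unfolding f3_def
        using g3(3) walk_support[OF g3(2)] walk_support[OF g3N] walk_flux[OF g3N N] closed_walk_vertex_sum[OF g3N g3(1) N]
        by simp_all
      have f3e: "f3 e1 = 0" "f3 e2 = 0" by (rule f3(2), simp add: F2_def F1_def)+
      have comb: "det2 a1 a2 * f3 e' - (det2 a3 a2 * f1 e' + det2 a1 a3 * f2 e') = 0" if "e' \<in> Eh" for e'
      proof (rule van[OF _ _ _ that])
        show "flux (\<lambda>e. det2 a1 a2 * f3 e - (det2 a3 a2 * f1 e + det2 a1 a3 * f2 e)) = 0"
          using det2_cramer[of a1 a2 a3] by (simp add: flux_diff flux_add flux_scale f1(3) f2(4) f3(4))
      qed (simp_all add: f1 f2 f3 vertex_sum_diff vertex_sum_add vertex_sum_scale)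
      have z1: "det2 a3 a2 = 0" using comb[OF e1E] f1(1) f2e1 f3e by simp
      then have "det2 a1 a3 = 0" using comb[OF e2E] f2(1) f3e by simp
      then show False using z1 comb[OF that] f3(1) det by simp
    qed
    define a where "a = x e1 *\<^sub>R a1 + x1 e2 *\<^sub>R a2"
    have "p - flux x2 \<in> \<int> \<times> \<int>" using x2int x2v by (intro lattice)
    then have a: "a \<in> \<int> \<times> \<int>" by (simp only: x2p a_def diff_diff_eq2 add_diff_cancel_left')
    \<comment> \<open>The first walk crosses the second one and also its translate by
      \<open>a\<close>; joining the two connections gives a closed walk with displacement
      \<open>a\<close>.\<close>
    from transverse_closed_walks_connected[OF g1(2) g2N g1(1) g2(1) N det]
    obtain g where g: "walk N (src e1) g (src e2)" ..
    have "walk N (a + src e2) g2 (a2 + (a + src e2))"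
      using walk_translate[OF g2N a] by (simp only: add.left_commute)
    from transverse_closed_walks_connected[OF g1(2) this g1(1) g2(1) N det]
    obtain g' where g': "walk N (src e1) g' (a + src e2)" ..
    define h where "h e = - g e + g' e" for e
    have h: "walk N (src e2) h (a + src e2)"
      unfolding h_def by (rule walk_trans[OF walk_sym[OF g N] g'])
    \<comment> \<open>Equal flux forces equal flows; at \<open>e1\<close> the right-hand combination
      is just \<open>x e1\<close>.\<close>
    have "real_of_int (h e1) - (x e1 * f1 e1 + x1 e2 * f2 e1) = 0"
    proof (rule van[of "\<lambda>e. real_of_int (h e) - (x e1 * f1 e + x1 e2 * f2 e)" e1])
      show "flux (\<lambda>e. real_of_int (h e) - (x e1 * f1 e + x1 e2 * f2 e)) = 0"
        using walk_flux[OF h N] by (simp add: flux_diff flux_add flux_scale f1(3) f2(4) a_def)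
    qed (use walk_support[OF h] closed_walk_vertex_sum[OF h a N] f1 f2 e1E in
        \<open>simp_all add: vertex_sum_diff vertex_sum_add vertex_sum_scale\<close>)
    then have "x e1 = real_of_int (h e1)" using f1(1) f2e1 by simp
    then show False using xe1 by simp
  qed
qed

section \<open>From fractional matchings to the polygon\<close>

lemma matching_indicator:
  assumes M: "M \<in> perfect_matchings Vh Eh"
  shows "(\<lambda>e. of_bool (e \<in> M)) \<in> fractional_matchings (\<Sum>e\<in>M. disp e)"
proof -
  have sub: "M \<subseteq> Eh" and ex1: "\<And>v. v \<in> Vh \<Longrightarrow> \<exists>!e. e \<in> M \<and> v \<in> e"
    using M by (auto simp: perfect_matchings_def)
  have "flux (\<lambda>e. of_bool (e \<in> M)) = (\<Sum>e\<in>Eh. if e \<in> M then disp e else 0)"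
    unfolding flux_def by (intro sum.cong) auto
  also have "\<dots> = (\<Sum>e\<in>M. disp e)"
    using sub finite_torus_edges by (simp add: sum.inter_restrict[symmetric] Int_absorb1)
  finally have "flux (\<lambda>e. of_bool (e \<in> M)) = (\<Sum>e\<in>M. disp e)" .
  moreover have "vertex_sum (\<lambda>e. of_bool (e \<in> M)) v = 1" if v: "v \<in> Vh" for v
  proof -
    from ex1[OF v] obtain e where e: "e \<in> M" "v \<in> e" "\<And>e'. e' \<in> M \<Longrightarrow> v \<in> e' \<Longrightarrow> e' = e" by blast
    have "vertex_sum (\<lambda>e. of_bool (e \<in> M)) v = (\<Sum>e'\<in>{e \<in> Eh. v \<in> e}. if e' = e then 1 else 0)"
      unfolding vertex_sum_def
    proof (rule sum.cong[OF refl])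
      fix e' assume "e' \<in> {e \<in> Eh. v \<in> e}"
      then have "e' \<in> M \<longleftrightarrow> e' = e" using e by blast
      then show "of_bool (e' \<in> M) = (if e' = e then 1 else 0 :: real)" by simp
    qed
    moreover have "e \<in> {e \<in> Eh. v \<in> e}" using e(1,2) sub by blast
    ultimately show ?thesis using finite_torus_edges by simp
  qed
  ultimately show ?thesis by (simp add: fractional_matchings_def)
qed

text \<open>All entries are 0 or 1, so \<open>x\<close> is the indicator of the edges with entry
  1.\<close>

lemma integral_fractional_matching:
  assumes x: "x \<in> fractional_matchings p" and int: "nonintegral x = {}"
  shows "\<exists>M\<in>perfect_matchings Vh Eh. (\<Sum>e\<in>M. disp e) = p"
proof -
  define M where "M = {e \<in> Eh. x e = 1}"
  have x01: "x e = of_bool (e \<in> M)" if "e \<in> Eh" for e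
  proof -
    have "x e \<in> \<int>" using int that unfolding nonintegral_def by blast
    then obtain n where n: "x e = of_int n" by (elim Ints_cases)
    have "0 \<le> x e" "x e \<le> 1" using x that unfolding fractional_matchings_def by blast+
    then have "n = 0 \<or> n = 1" using n by auto
    then show ?thesis using n that by (auto simp: M_def)
  qed
  have sub: "M \<subseteq> Eh" unfolding M_def by blast
  have "\<exists>!e. e \<in> M \<and> v \<in> e" if v: "v \<in> Vh" for v
  proof -
    have "1 = vertex_sum x v" using x v unfolding fractional_matchings_def by simp
    also have "\<dots> = (\<Sum>e\<in>{e \<in> Eh. v \<in> e}. of_bool (e \<in> M))"
      unfolding vertex_sum_def using x01 by (intro sum.cong) auto
    also have "\<dots> = real (card ({e \<in> Eh. v \<in> e} \<inter> M))"
      using finite_torus_edges by simp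
    also have "{e \<in> Eh. v \<in> e} \<inter> M = {e. e \<in> M \<and> v \<in> e}" using sub by blast
    finally have "card {e. e \<in> M \<and> v \<in> e} = 1" by simp
    then obtain e where "{e. e \<in> M \<and> v \<in> e} = {e}" by (rule card_1_singletonE)
    then show ?thesis by (intro ex1I[of _ e]) blast+
  qed
  then have M: "M \<in> perfect_matchings Vh Eh" using sub by (simp add: perfect_matchings_def)
  have "flux x = flux (\<lambda>e. of_bool (e \<in> M))"
    unfolding flux_def using x01 by (intro sum.cong) auto
  then have "(\<Sum>e\<in>M. disp e) = p"
    using x matching_indicator[OF M] unfolding fractional_matchings_def by simp
  with M show ?thesis by (rule bexI[rotated])
qed

lemma matching_of_fractional_matching:
  assumes x: "x \<in> fractional_matchings p" and M0: "M0 \<in> perfect_matchings Vh Eh"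
    and p: "p - (\<Sum>e\<in>M0. disp e) \<in> \<int> \<times> \<int>"
  shows "\<exists>M\<in>perfect_matchings Vh Eh. (\<Sum>e\<in>M. disp e) = p"
proof -
  from ex_has_least_nat[of "\<lambda>x. x \<in> fractional_matchings p", OF x, of "\<lambda>x. card (nonintegral x)"]
  obtain y where y: "y \<in> fractional_matchings p"
    "\<And>z. z \<in> fractional_matchings p \<Longrightarrow> card (nonintegral y) \<le> card (nonintegral z)" by blast
  have "nonintegral y = {}"
    by (rule minimal_fractional_matching_integral[OF y, where c = "\<lambda>e. of_bool (e \<in> M0)"])
      (use matching_indicator[OF M0] p in \<open>simp_all add: fractional_matchings_def\<close>)
  with y(1) show ?thesis by (rule integral_fractional_matching)
qed

lemma homology_types_eq:
  assumes M0: "M0 \<in> perfect_matchings Vh Eh"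
  shows "homology_types V E W B M0 = {(\<Sum>e\<in>M. disp e) - (\<Sum>e\<in>M0. disp e) |M. M \<in> perfect_matchings Vh Eh}"
  unfolding homology_types_def using lattice_point_homology_type[OF _ M0] by (intro Collect_cong ex_cong1) auto

text \<open>Fractional matchings are closed under convex combinations and the flux is linear, so the
  attainable fluxes form a convex set containing the homology types.\<close>

lemma newton_polygon_fractional:
  assumes M0: "M0 \<in> perfect_matchings Vh Eh" and z: "z \<in> newton_polygon V E W B M0"
  shows "fractional_matchings (z + (\<Sum>e\<in>M0. disp e)) \<noteq> {}"
proof -
  define Q where "Q = {z. \<exists>x. x \<in> fractional_matchings (z + (\<Sum>e\<in>M0. disp e))}"
  have "homology_types V E W B M0 \<subseteq> Q"
    unfolding homology_types_eq[OF M0] Q_def using matching_indicator by fastforce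
  moreover have "convex Q"
  proof (rule convexI)
    fix y z :: plane and u v :: real
    assume "y \<in> Q" "z \<in> Q" and uv: "0 \<le> u" "0 \<le> v" "u + v = 1"
    then obtain a b where a: "a \<in> fractional_matchings (y + (\<Sum>e\<in>M0. disp e))"
      and b: "b \<in> fractional_matchings (z + (\<Sum>e\<in>M0. disp e))" unfolding Q_def by blast
    have s: "s = u *\<^sub>R s + v *\<^sub>R s" for s :: plane using uv(3) by (metis scaleR_add_left scaleR_one)
    have "flux (\<lambda>e. u * a e + v * b e) = u *\<^sub>R (y + (\<Sum>e\<in>M0. disp e)) + v *\<^sub>R (z + (\<Sum>e\<in>M0. disp e))"
      using a b by (simp add: fractional_matchings_def flux_add flux_scale)
    also have "\<dots> = u *\<^sub>R y + v *\<^sub>R z + (\<Sum>e\<in>M0. disp e)"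
      using s[of "\<Sum>e\<in>M0. disp e"] by (simp add: scaleR_add_right)
    finally have "flux (\<lambda>e. u * a e + v * b e) = u *\<^sub>R y + v *\<^sub>R z + (\<Sum>e\<in>M0. disp e)" .
    moreover have "0 \<le> u * a e + v * b e \<and> u * a e + v * b e \<le> 1" if "e \<in> Eh" for e
    proof
      have ab: "0 \<le> a e" "a e \<le> 1" "0 \<le> b e" "b e \<le> 1"
        using a b that unfolding fractional_matchings_def by blast+
      show "0 \<le> u * a e + v * b e" using ab uv by simp
      have "u * a e \<le> u" "v * b e \<le> v" using ab uv by (simp_all add: mult_left_le)
      then show "u * a e + v * b e \<le> 1" using uv by linarith
    qed
    moreover have "vertex_sum (\<lambda>e. u * a e + v * b e) w = 1" if "w \<in> Vh" for w
      using a b uv that unfolding fractional_matchings_def by (simp add: vertex_sum_add vertex_sum_scale)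
    ultimately have "(\<lambda>e. u * a e + v * b e) \<in> fractional_matchings (u *\<^sub>R y + v *\<^sub>R z + (\<Sum>e\<in>M0. disp e))"
      unfolding fractional_matchings_def by blast
    then show "u *\<^sub>R y + v *\<^sub>R z \<in> Q" unfolding Q_def by blast
  qed
  ultimately have "newton_polygon V E W B M0 \<subseteq> Q"
    unfolding newton_polygon_def by (rule hull_minimal)
  then show ?thesis using z unfolding Q_def by blast
qed

end

theorem mainTheorem1:
  fixes V W B :: "plane set" and E :: "plane set set" and \<omega>0 :: "torus_point set set"
  assumes "bipartite_periodic_graph V E W B"
    and "\<omega>0 \<in> perfect_matchings (torus_vertices V) (torus_edges E)"
  shows "newton_polygon V E W B \<omega>0 \<inter> (\<int> \<times> \<int>) = homology_types V E W B \<omega>0"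
proof -
  interpret bipartite_periodic V W B E
    by (rule bipartite_periodic.intro) (rule assms(1))
  show ?thesis
  proof (intro subset_antisym subsetI)
    fix z assume "z \<in> newton_polygon V E W B \<omega>0 \<inter> (\<int> \<times> \<int>)"
    then have z: "z \<in> newton_polygon V E W B \<omega>0" "z \<in> \<int> \<times> \<int>" by (rule IntD1, rule IntD2)
    from newton_polygon_fractional[OF assms(2) z(1)]
    obtain x where x: "x \<in> fractional_matchings (z + (\<Sum>e\<in>\<omega>0. disp e))" by blast
    \<comment> \<open>The reference matching supplies the integral vector whose flux differs from
      the target by the lattice point \<open>z\<close>.\<close>
    have "z + (\<Sum>e\<in>\<omega>0. disp e) - (\<Sum>e\<in>\<omega>0. disp e) \<in> \<int> \<times> \<int>"
      using z(2) by (simp only: add_diff_cancel_right')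
    from matching_of_fractional_matching[OF x assms(2) this]
    obtain M where M: "M \<in> perfect_matchings (torus_vertices V) (torus_edges E)"
      "(\<Sum>e\<in>M. disp e) = z + (\<Sum>e\<in>\<omega>0. disp e)" ..
    then have "z = (\<Sum>e\<in>M. disp e) - (\<Sum>e\<in>\<omega>0. disp e)" by simp
    with M(1) show "z \<in> homology_types V E W B \<omega>0"
      unfolding homology_types_eq[OF assms(2)] by blast
  next
    fix z assume z: "z \<in> homology_types V E W B \<omega>0"
    then have "z \<in> newton_polygon V E W B \<omega>0"
      unfolding newton_polygon_def by (rule hull_inc)
    moreover have "z \<in> \<int> \<times> \<int>"
      using z lattice_point_in_Ints unfolding homology_types_def by blast
    ultimately show "z \<in> newton_polygon V E W B \<omega>0 \<inter> (\<int> \<times> \<int>)" by (rule IntI)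
  qed
qed

end
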